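(* Let $f:\mathcal{R}\to\Omega$ be SP. Then the function $\omega$ (given by $\omega(\mathbf{p})=\Omega(\mathbf{p})$) is a generalized median voter function on its range $r_\omega$, with $r_\omega$ satisfying the range conditions.
   Context: Model. $X\subseteq\mathbb{R}$ is a set of alternatives; $N=\{1,\dots,n\}$ is a finite set of agents partitioned into $A$ (with $|A|=a$, possibly $0$) and $D=N\setminus A$ (possibly empty). A preference $R_i$ is a complete, transitive, antisymmetric binary relation on $X$ with strict part $P_i$. For $i\in A$, $\mathcal{R}_i$ is the set of all single-peaked preferences: those for which there is $\rho(R_i)\in X$ such that for all $x,y\in X$, [$\rho(R_i)\ge x>y$ or $\rho(R_i)\le x<y$] implies $x\,P_i\,y$. For $i\in D$, $\mathcal{R}_i$ is the set of all single-dipped preferences: those for which there is $\delta(R_i)\in X$ such that for all $x,y\in X$, [$\delta(R_i)\ge x>y$ or $\delta(R_i)\le x<y$] implies $y\,P_i\,x$. $\mathcal{R}=\times_{i\in N}\mathcal{R}_i$. A social choice rule is a function $f:\mathcal{R}\to X$; $\Omega$ denotes its range, and writing $f:\mathcal{R}\to\Omega$ means that the range of $f$ is $\Omega$. $f$ is strategy-proof (SP) if there are no $i\in N$, $R\in\mathcal{R}$, $R'_i\in\mathcal{R}_i$ with $f(R'_i,R_{-i})\,P_i\,f(R)$. Standing assumptions: $\mathbb{R}\setminus\Omega$ is either empty or a union of open sets, and $|\Omega|\ge2$. For $i\in A$, $p(R_i)$ is the best element of $\Omega$ under $R_i$; $p(R)=(p(R_i))_{i\in A}\in\Omega^a$ (for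 $a=0$, $\Omega^a$ contains only the empty vector). For $\mathbf{p}\in\Omega^a$, $\omega(\mathbf{p})=\Omega(\mathbf{p})=\{x\in\Omega:\exists R\in\mathcal{R},\ p(R)=\mathbf{p},\ f(R)=x\}$, where a singleton is identified with its element and a two-element set $\{x,y\}$, $x<y$, with the ordered pair $(x,y)$ (for SP rules $|\Omega(\mathbf{p})|\le2$). $r_\omega$ is the range of $\omega$. $\Omega^2_C=\{(x,y)\in\Omega\times\Omega: x<y,\ (x,y)\cap\Omega=\emptyset\}$ (in the last condition $(x,y)$ is the open interval). The order $\leq^*$ on $\Omega\cup\Omega^2_C$ (strict part $<^*$) is the complete transitive relation that agrees with $\le$ on $\Omega$ and satisfies $x<^*(x,y)<^*y$ for each $(x,y)\in\Omega^2_C$. Range conditions on $r_\omega$: (1) $\Omega\setminus\{\min\Omega,\max\Omega\}\subseteq r_\omega\subseteq\Omega\cup\Omega^2_C$ (removing $\min\Omega,\max\Omega$ when they exist); (2) if $\min\Omega$ exists and there is no $x\in\Omega$ with $(\min\Omega,x)\in r_\omega$, then $\min\Omega\in r_\omega$; (3) if $\max\Omega$ exists and there is no $x\in\Omega$ with $(x,\max\Omega)\in r_\omega$, then $\max\Omega\in r_\omega$. A left coalition system on $r_\omega$ is a map $\mathcal{L}$ assigning to each $\alpha\in r_\omega$ a collection $\mathcal{L}(\alpha)\subseteq2^A$ such that: (i) if $C\in\mathcal{L}(\alpha)$ and $C\subset C'\subseteq A$, then $C'\in\mathcal{L}(\alpha)$; (ii) if $\alpha<^*\beta$ and $C\in\mathcal{L}(\alpha)$,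 then $C\in\mathcal{L}(\beta)$; (iii) if $\max\Omega$ exists and $\max\Omega\notin r_\omega$, then $\emptyset\in\mathcal{L}(\max r_\omega)\setminus\mathcal{L}(\alpha)$ for each $\alpha\in r_\omega\setminus\{\max r_\omega\}$ (max with respect to $\leq^*$); (iv) if $\max\Omega$ does not exist, then $\emptyset\notin\mathcal{L}(\alpha)$ for each $\alpha\in r_\omega$. $\omega$ is a generalized median voter function on $r_\omega$ if there is a left coalition system $\mathcal{L}$ on $r_\omega$ such that for each $\mathbf{p}\in\Omega^a$ and $\alpha\in r_\omega$: $\omega(\mathbf{p})=\alpha$ if and only if $\{i\in A:\mathbf{p}_i\leq^*\alpha\}\in\mathcal{L}(\alpha)$ and $\{i\in A:\mathbf{p}_i\leq^*\beta\}\notin\mathcal{L}(\beta)$ for each $\beta\in r_\omega$ with $\beta<^*\alpha$. *)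

theory Defs
  imports Complex_Main "HOL-Library.FuncSet"
begin

text \<open>
  A relation \<open>r\<close> is read as a weak preference or weak order: \<open>(x, y) \<in> r\<close> means \<open>x r y\<close>.
\<close>

definition strict_part :: "'a rel \<Rightarrow> 'a \<Rightarrow> 'a \<Rightarrow> bool" where
  "strict_part r x y \<longleftrightarrow> (x, y) \<in> r \<and> (y, x) \<notin> r"

definition is_min :: "real set \<Rightarrow> real \<Rightarrow> bool" where
  "is_min S m \<longleftrightarrow> m \<in> S \<and> (\<forall>x\<in>S. m \<le> x)"

definition is_max :: "real set \<Rightarrow> real \<Rightarrow> bool" where
  "is_max S m \<longleftrightarrow> m \<in> S \<and> (\<forall>x\<in>S. x \<le> m)"


subsection \<open>Preferences, profiles and rules\<close>

definition single_peaked :: "real set \<Rightarrow> real rel set" where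
  "single_peaked X = {R. linear_order_on X R \<and>
     (\<exists>\<rho>\<in>X. \<forall>x\<in>X. \<forall>y\<in>X. (\<rho> \<ge> x \<and> x > y) \<or> (\<rho> \<le> x \<and> x < y) \<longrightarrow> strict_part R x y)}"

definition single_dipped :: "real set \<Rightarrow> real rel set" where
  "single_dipped X = {R. linear_order_on X R \<and>
     (\<exists>\<delta>\<in>X. \<forall>x\<in>X. \<forall>y\<in>X. (\<delta> \<ge> x \<and> x > y) \<or> (\<delta> \<le> x \<and> x < y) \<longrightarrow> strict_part R y x)}"

definition prefs :: "real set \<Rightarrow> nat set \<Rightarrow> nat \<Rightarrow> real rel set" where
  "prefs X A i = (if i \<in> A then single_peaked X else single_dipped X)"

definition profiles :: "real set \<Rightarrow> nat \<Rightarrow> nat set \<Rightarrow> (nat \<Rightarrow> real rel) set" where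
  "profiles X n A = (\<Pi>\<^sub>E i\<in>{1..n}. prefs X A i)"

definition strategy_proof ::
  "real set \<Rightarrow> nat \<Rightarrow> nat set \<Rightarrow> ((nat \<Rightarrow> real rel) \<Rightarrow> real) \<Rightarrow> bool" where
  "strategy_proof X n A f \<longleftrightarrow>
     \<not> (\<exists>i\<in>{1..n}. \<exists>R\<in>profiles X n A. \<exists>R'\<in>prefs X A i.
          strict_part (R i) (f (R(i := R'))) (f R))"

text \<open>
  The definite description is proper for single-peaked \<open>R\<close> when \<open>\<Omega> \<subseteq> X\<close> is closed and nonempty.
\<close>

definition best :: "real set \<Rightarrow> real rel \<Rightarrow> real" where
  "best \<Omega> R = (THE x. x \<in> \<Omega> \<and> (\<forall>y\<in>\<Omega>. (x, y) \<in> R))"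

definition best_profile :: "nat set \<Rightarrow> real set \<Rightarrow> (nat \<Rightarrow> real rel) \<Rightarrow> nat \<Rightarrow> real" where
  "best_profile A \<Omega> R = (\<lambda>i\<in>A. best \<Omega> (R i))"

text \<open>
  The values of \<open>\<omega>\<close> are kept as sets: an alternative \<open>x\<close> is represented by \<open>{x}\<close>
  and an ordered pair \<open>(x, y)\<close> with \<open>x < y\<close> by \<open>{x, y}\<close>. Thus \<open>\<omega>\<close> is literally the
  set-valued map, and that its values have at most two elements is not built in.
\<close>

definition omega ::
  "real set \<Rightarrow> nat \<Rightarrow> nat set \<Rightarrow> ((nat \<Rightarrow> real rel) \<Rightarrow> real) \<Rightarrow> real set \<Rightarrow> (nat \<Rightarrow> real) \<Rightarrow> real set" where
  "omega X n A f \<Omega> p = {x \<in> \<Omega>. \<exists>R\<in>profiles X n A. best_profile A \<Omega> R = p \<and> f R = x}"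


subsection \<open>Alternatives, adjacent pairs and their order\<close>

definition points :: "real set \<Rightarrow> real set set" where
  "points \<Omega> = (\<lambda>x. {x}) ` \<Omega>"

definition adjacent :: "real set \<Rightarrow> real \<Rightarrow> real \<Rightarrow> bool" where
  "adjacent \<Omega> x y \<longleftrightarrow> x \<in> \<Omega> \<and> y \<in> \<Omega> \<and> x < y \<and> {x<..<y} \<inter> \<Omega> = {}"

definition adjacent_pairs :: "real set \<Rightarrow> real set set" where
  "adjacent_pairs \<Omega> = {{x, y} | x y. adjacent \<Omega> x y}"

definition is_star_order :: "real set \<Rightarrow> real set rel \<Rightarrow> bool" where
  "is_star_order \<Omega> le \<longleftrightarrow>
     (let V = points \<Omega> \<union> adjacent_pairs \<Omega> in
       le \<subseteq> V \<times> V \<and>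
       (\<forall>\<alpha>\<in>V. \<forall>\<beta>\<in>V. (\<alpha>, \<beta>) \<in> le \<or> (\<beta>, \<alpha>) \<in> le) \<and>
       trans le \<and>
       (\<forall>x\<in>\<Omega>. \<forall>y\<in>\<Omega>. ({x}, {y}) \<in> le \<longleftrightarrow> x \<le> y) \<and>
       (\<forall>x y. adjacent \<Omega> x y \<longrightarrow> strict_part le {x} {x, y} \<and> strict_part le {x, y} {y}))"

definition star_order :: "real set \<Rightarrow> real set rel" where
  "star_order \<Omega> = (THE le. is_star_order \<Omega> le)"

definition explicit_order :: "real set \<Rightarrow> real set rel" where
  "explicit_order \<Omega> = {(\<alpha>, \<beta>). \<alpha> \<in> points \<Omega> \<union> adjacent_pairs \<Omega> \<and>
     \<beta> \<in> points \<Omega> \<union> adjacent_pairs \<Omega> \<and> Min \<alpha> \<le> Min \<beta> \<and> Max \<alpha> \<le> Max \<beta>}"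

lemma value_cases:
  assumes "\<alpha> \<in> points \<Omega> \<union> adjacent_pairs \<Omega>"
  obtains x y where "\<alpha> = {x, y}" "x \<in> \<Omega>" "y \<in> \<Omega>" "x = y \<or> adjacent \<Omega> x y"
    "Min \<alpha> = x" "Max \<alpha> = y" "x \<le> y"
proof -
  from assms have "(\<exists>x. \<alpha> = {x} \<and> x \<in> \<Omega>) \<or> (\<exists>x y. \<alpha> = {x, y} \<and> adjacent \<Omega> x y)"
    unfolding points_def adjacent_pairs_def by blast
  then show thesis
  proof (elim disjE exE conjE)
    fix x assume "\<alpha> = {x}" "x \<in> \<Omega>"
    then show thesis by (intro that[of x x]) simp_all
  next
    fix x y assume "\<alpha> = {x, y}" "adjacent \<Omega> x y"
    then show thesis by (intro that[of x y]) (simp_all add: adjacent_def)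
  qed
qed

lemma adjacent_gap: "adjacent \<Omega> x y \<Longrightarrow> z \<in> \<Omega> \<Longrightarrow> z \<le> x \<or> y \<le> z"
  unfolding adjacent_def by force

lemma is_star_order_explicit: "is_star_order \<Omega> (explicit_order \<Omega>)"
proof -
  let ?V = "points \<Omega> \<union> adjacent_pairs \<Omega>"
  have total: "(\<alpha>, \<beta>) \<in> explicit_order \<Omega> \<or> (\<beta>, \<alpha>) \<in> explicit_order \<Omega>"
    if V: "\<alpha> \<in> ?V" "\<beta> \<in> ?V" for \<alpha> \<beta>
  proof -
    obtain x y where a: "x \<in> \<Omega>" "y \<in> \<Omega>" "x = y \<or> adjacent \<Omega> x y" "Min \<alpha> = x" "Max \<alpha> = y" "x \<le> y"
      using value_cases[OF V(1)] by metis
    obtain u v where b: "u \<in> \<Omega>" "v \<in> \<Omega>" "u = v \<or> adjacent \<Omega> u v" "Min \<beta> = u" "Max \<beta> = v" "u \<le> v"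
      using value_cases[OF V(2)] by metis
    have "(x \<le> u \<and> y \<le> v) \<or> (u \<le> x \<and> v \<le> y)"
    proof (cases "x \<le> u")
      case True
      have "u = x \<or> y \<le> u"
        using a(3)
      proof
        assume "x = y" then show ?thesis using True by simp
      next
        assume "adjacent \<Omega> x y"
        from adjacent_gap[OF this b(1)] show ?thesis using True by linarith
      qed
      with True b(6) show ?thesis by linarith
    next
      case False
      have "v \<le> x"
        using b(3)
      proof
        assume "u = v" then show ?thesis using False by simp
      next
        assume "adjacent \<Omega> u v"
        from adjacent_gap[OF this a(1)] show ?thesis using False by linarith
      qed
      with False a(6) show ?thesis by linarith
    qed
    then show ?thesis using V a(4,5) b(4,5) by (simp add: explicit_order_def)
  qed
  have adj: "strict_part (explicit_order \<Omega>) {x} {x, y} \<and> strict_part (explicit_order \<Omega>) {x, y} {y}"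
    if "adjacent \<Omega> x y" for x y
  proof -
    have "{x, y} \<in> ?V" using that unfolding adjacent_pairs_def by blast
    moreover have "{x} \<in> ?V" "{y} \<in> ?V" "x < y"
      using that unfolding adjacent_def points_def by blast+
    ultimately show ?thesis by (simp add: strict_part_def explicit_order_def)
  qed
  show ?thesis
    unfolding is_star_order_def Let_def
  proof (intro conjI ballI allI impI)
    show "explicit_order \<Omega> \<subseteq> ?V \<times> ?V" "trans (explicit_order \<Omega>)"
      unfolding explicit_order_def by (blast, intro transI, use order_trans in blast)
    show "({x}, {y}) \<in> explicit_order \<Omega> \<longleftrightarrow> x \<le> y" if "x \<in> \<Omega>" "y \<in> \<Omega>" for x y
      using that by (simp add: explicit_order_def points_def)
  next
    fix \<alpha> \<beta> assume "\<alpha> \<in> ?V" "\<beta> \<in> ?V"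
    then show "(\<alpha>, \<beta>) \<in> explicit_order \<Omega> \<or> (\<beta>, \<alpha>) \<in> explicit_order \<Omega>" by (rule total)
  next
    fix x y assume "adjacent \<Omega> x y"
    note xy = adj[OF this]
    show "strict_part (explicit_order \<Omega>) {x} {x, y}" by (rule conjunct1[OF xy])
    show "strict_part (explicit_order \<Omega>) {x, y} {y}" by (rule conjunct2[OF xy])
  qed
qed

lemma is_star_order_unique:
  assumes "is_star_order \<Omega> le"
  shows "le = explicit_order \<Omega>"
proof -
  let ?V = "points \<Omega> \<union> adjacent_pairs \<Omega>"
  have sub: "le \<subseteq> ?V \<times> ?V" and tr: "trans le"
    and tot: "\<And>\<alpha> \<beta>. \<alpha> \<in> ?V \<Longrightarrow> \<beta> \<in> ?V \<Longrightarrow> (\<alpha>, \<beta>) \<in> le \<or> (\<beta>, \<alpha>) \<in> le"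
    and pt: "\<And>x y. x \<in> \<Omega> \<Longrightarrow> y \<in> \<Omega> \<Longrightarrow> ({x}, {y}) \<in> le \<longleftrightarrow> x \<le> y"
    and adj: "\<And>x y. adjacent \<Omega> x y \<Longrightarrow> strict_part le {x} {x, y} \<and> strict_part le {x, y} {y}"
    using assms unfolding is_star_order_def Let_def by meson+
  have lo: "({x}, {x, y}) \<in> le" "({x, y}, {y}) \<in> le"
    if "x \<in> \<Omega>" "y \<in> \<Omega>" "x = y \<or> adjacent \<Omega> x y" for x y
    using that adj[of x y] pt[of x x] by (auto simp: strict_part_def)
  have key: "(\<alpha>, \<beta>) \<in> le \<longleftrightarrow> Min \<alpha> \<le> Min \<beta> \<and> Max \<alpha> \<le> Max \<beta>"
    if V: "\<alpha> \<in> ?V" "\<beta> \<in> ?V" for \<alpha> \<beta>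
  proof -
    obtain x y where a: "\<alpha> = {x, y}" "x \<in> \<Omega>" "y \<in> \<Omega>" "x = y \<or> adjacent \<Omega> x y"
      "Min \<alpha> = x" "Max \<alpha> = y" "x \<le> y"
      using value_cases[OF V(1)] by metis
    obtain u v where b: "\<beta> = {u, v}" "u \<in> \<Omega>" "v \<in> \<Omega>" "u = v \<or> adjacent \<Omega> u v"
      "Min \<beta> = u" "Max \<beta> = v" "u \<le> v"
      using value_cases[OF V(2)] by metis
    have 1: "x \<le> v" if "(\<alpha>, \<beta>) \<in> le"
      using that lo(1)[of x y] lo(2)[of u v] pt[of x v] a b tr by (meson transD)
    have le: "(\<alpha>, \<beta>) \<in> le" if "y \<le> u"
      using that lo(2)[of x y] lo(1)[of u v] pt[of y u] a b tr by (metis transD)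
    have refl: "(\<alpha>, \<alpha>) \<in> le" using tot V(1) by blast
    show ?thesis
    proof
      assume h: "(\<alpha>, \<beta>) \<in> le"
      have "x \<le> u"
      proof (rule ccontr)
        assume "\<not> x \<le> u"
        with 1[OF h] b adjacent_gap[of \<Omega> u v x] a(2) have uv: "adjacent \<Omega> u v" "x = v" by auto
        have "({v}, \<beta>) \<in> le" using h lo(1)[of x y] a uv tr by (metis transD)
        with adj[OF uv(1)] b show False by (auto simp: strict_part_def)
      qed
      moreover have "y \<le> v"
      proof (rule ccontr)
        assume "\<not> y \<le> v"
        with 1[OF h] a adjacent_gap[of \<Omega> x y v] b(3) have xy: "adjacent \<Omega> x y" "x = v" by auto
        have "(\<alpha>, {x}) \<in> le" using h lo(2)[of u v] b xy tr by (metis transD)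
        with adj[OF xy(1)] a show False by (auto simp: strict_part_def)
      qed
      ultimately show "Min \<alpha> \<le> Min \<beta> \<and> Max \<alpha> \<le> Max \<beta>" using a b by simp
    next
      assume "Min \<alpha> \<le> Min \<beta> \<and> Max \<alpha> \<le> Max \<beta>"
      then have h: "x \<le> u" "y \<le> v" using a b by auto
      show "(\<alpha>, \<beta>) \<in> le"
      proof (cases "y \<le> u")
        case False
        then have xu: "x = u"
          using h a b adjacent_gap[of \<Omega> x y u] by auto
        have yv: "y = v \<or> y = u"
          using h a b False adjacent_gap[of \<Omega> u v y] by auto
        then show ?thesis using xu False refl a b by auto
      qed (rule le)
    qed
  qed
  show ?thesis
  proof (rule set_eqI)
    fix z :: "real set \<times> real set"
    obtain \<alpha> \<beta> where z: "z = (\<alpha>, \<beta>)" by (cases z)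
    show "z \<in> le \<longleftrightarrow> z \<in> explicit_order \<Omega>"
    proof (cases "\<alpha> \<in> ?V \<and> \<beta> \<in> ?V")
      case True
      then show ?thesis
        unfolding z explicit_order_def using key[of \<alpha> \<beta>] by simp
    next
      case False
      then show ?thesis
        unfolding z explicit_order_def using sub by blast
    qed
  qed
qed

lemma star_order_eq: "star_order \<Omega> = explicit_order \<Omega>"
  unfolding star_order_def
proof (rule the_equality)
  show "is_star_order \<Omega> (explicit_order \<Omega>)" by (rule is_star_order_explicit)
qed (rule is_star_order_unique)


subsection \<open>Range conditions and generalized median voter functions\<close>

definition range_conditions :: "real set \<Rightarrow> real set set \<Rightarrow> bool" where
  "range_conditions \<Omega> r \<longleftrightarrow>
     points {x \<in> \<Omega>. \<not> is_min \<Omega> x \<and> \<not> is_max \<Omega> x} \<subseteq> r \<and>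
     r \<subseteq> points \<Omega> \<union> adjacent_pairs \<Omega> \<and>
     (\<forall>m. is_min \<Omega> m \<and> \<not> (\<exists>x\<in>\<Omega>. m < x \<and> {m, x} \<in> r) \<longrightarrow> {m} \<in> r) \<and>
     (\<forall>m. is_max \<Omega> m \<and> \<not> (\<exists>x\<in>\<Omega>. x < m \<and> {x, m} \<in> r) \<longrightarrow> {m} \<in> r)"

text \<open>
  In the fourth conjunct \<open>\<mu>\<close> is the maximum of \<open>r\<close>, whose existence is asserted.
\<close>

definition left_coalition_system ::
  "nat set \<Rightarrow> real set \<Rightarrow> real set set \<Rightarrow> (real set \<Rightarrow> nat set set) \<Rightarrow> bool" where
  "left_coalition_system A \<Omega> r L \<longleftrightarrow>
     (\<forall>\<alpha>\<in>r. L \<alpha> \<subseteq> Pow A) \<and>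
     (\<forall>\<alpha>\<in>r. \<forall>C C'. C \<in> L \<alpha> \<and> C \<subseteq> C' \<and> C' \<subseteq> A \<longrightarrow> C' \<in> L \<alpha>) \<and>
     (\<forall>\<alpha>\<in>r. \<forall>\<beta>\<in>r. \<forall>C. strict_part (star_order \<Omega>) \<alpha> \<beta> \<and> C \<in> L \<alpha> \<longrightarrow> C \<in> L \<beta>) \<and>
     (\<forall>m. is_max \<Omega> m \<and> {m} \<notin> r \<longrightarrow>
        (\<exists>\<mu>\<in>r. (\<forall>\<alpha>\<in>r. (\<alpha>, \<mu>) \<in> star_order \<Omega>) \<and>
           {} \<in> L \<mu> \<and> (\<forall>\<alpha>\<in>r - {\<mu>}. {} \<notin> L \<alpha>))) \<and>
     ((\<nexists>m. is_max \<Omega> m) \<longrightarrow> (\<forall>\<alpha>\<in>r. {} \<notin> L \<alpha>))"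

definition generalized_median_voter_function ::
  "nat set \<Rightarrow> real set \<Rightarrow> real set set \<Rightarrow> ((nat \<Rightarrow> real) \<Rightarrow> real set) \<Rightarrow> bool" where
  "generalized_median_voter_function A \<Omega> r \<omega> \<longleftrightarrow>
     (\<exists>L. left_coalition_system A \<Omega> r L \<and>
       (\<forall>p\<in>A \<rightarrow>\<^sub>E \<Omega>. \<forall>\<alpha>\<in>r. \<omega> p = \<alpha> \<longleftrightarrow>
          {i \<in> A. ({p i}, \<alpha>) \<in> star_order \<Omega>} \<in> L \<alpha> \<and>
          (\<forall>\<beta>\<in>r. strict_part (star_order \<Omega>) \<beta> \<alpha> \<longrightarrow>
             {i \<in> A. ({p i}, \<beta>) \<in> star_order \<Omega>} \<notin> L \<beta>)))"

end

theory Submission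
  imports Defs
begin

text \<open>
  Each step compares two profiles by replacing preferences one agent at a time; strategy-proofness
  makes every single replacement move the outcome downwards in the old preference and upwards in
  the new one. For an alternative \<open>z\<close> of \<open>\<Omega>\<close> with members of \<open>\<Omega>\<close> on both sides this gives unanimity:
  if every agent of \<open>A\<close> has \<open>z\<close> on top, the outcome is \<open>z\<close>. The key is that it suffices to obtain \<open>z\<close>
  once while every agent of \<open>D\<close> has \<open>z\<close> at the bottom. Unanimity implies that the outcome cannot lie
  left of \<open>z\<close> when all tops are at or right of it, that two outcomes for the same tops never straddle
  a third alternative of \<open>\<Omega>\<close>, and that \<open>\<omega> p \<le>\<^sup>* \<alpha>\<close> depends, monotonically, only on the set of agents
  with \<open>p\<^sub>i \<le>\<^sup>* \<alpha>\<close>. The sets for which it holds form the left coalition system.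
\<close>

subsection \<open>Extremal preferences\<close>

text \<open>
  Left-right symmetry is handled by stating lemmas for an orientation \<open>u\<close>, the identity or negation
  of the reals, with \<open>v\<close> the reverse orientation.
\<close>

definition opposite :: "(real \<Rightarrow> real) \<Rightarrow> (real \<Rightarrow> real) \<Rightarrow> bool" where
  "opposite u v \<longleftrightarrow> (u = (\<lambda>x. x) \<and> v = uminus) \<or> (u = uminus \<and> v = (\<lambda>x. x))"

lemma opposite_sym: "opposite u v \<Longrightarrow> opposite v u"
  by (auto simp: opposite_def)

lemma opposite_neg: "opposite u v \<Longrightarrow> v x = - u x"
  by (auto simp: opposite_def)

lemma opposite_inj: "opposite u v \<Longrightarrow> u x = u y \<longleftrightarrow> x = y"
  by (auto simp: opposite_def)

lemma opposite_id: "opposite (\<lambda>x. x) uminus"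
  by (simp add: opposite_def)

text \<open>
  With respect to \<open>u\<close>, everything left of the peak \<open>z\<close> is preferred to everything right of it; for the
  dip at \<open>z\<close>, everything right is preferred to everything left.
\<close>

definition peak_pref :: "real set \<Rightarrow> (real \<Rightarrow> real) \<Rightarrow> real \<Rightarrow> real rel" where
  "peak_pref X u z = {(x, y). x \<in> X \<and> y \<in> X \<and>
     (if u x \<le> u z then u y \<le> u x \<or> u z < u y else u x \<le> u y)}"

definition dip_pref :: "real set \<Rightarrow> (real \<Rightarrow> real) \<Rightarrow> real \<Rightarrow> real rel" where
  "dip_pref X u z = (peak_pref X u z)\<inverse>"

lemma linear_order_peak_pref:
  assumes "opposite u v"
  shows "linear_order_on X (peak_pref X u z)"
proof -
  have "x = y" if "(x, y) \<in> peak_pref X u z" "(y, x) \<in> peak_pref X u z" for x y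
  proof -
    have "u x = u y" using that by (auto simp: peak_pref_def split: if_splits)
    then show ?thesis by (simp add: opposite_inj[OF assms])
  qed
  then show ?thesis
    unfolding order_on_defs
    by (intro conjI refl_onI transI antisymI total_onI subsetI)
      (auto simp: peak_pref_def split: if_splits)
qed

lemma peak_pref_single_peaked:
  assumes "opposite u v" "z \<in> X"
  shows "peak_pref X u z \<in> single_peaked X"
  unfolding single_peaked_def
proof (intro CollectI conjI)
  show "linear_order_on X (peak_pref X u z)"
    by (rule linear_order_peak_pref[OF assms(1)])
  show "\<exists>\<rho>\<in>X. \<forall>x\<in>X. \<forall>y\<in>X. \<rho> \<ge> x \<and> x > y \<or> \<rho> \<le> x \<and> x < y \<longrightarrow> strict_part (peak_pref X u z) x y"
    by (rule bexI[OF _ assms(2)])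
      (use assms(1) in \<open>auto simp: peak_pref_def strict_part_def opposite_def\<close>)
qed

lemma dip_pref_single_dipped:
  assumes "opposite u v" "z \<in> X"
  shows "dip_pref X u z \<in> single_dipped X"
  unfolding single_dipped_def
proof (intro CollectI conjI)
  show "linear_order_on X (dip_pref X u z)"
    using linear_order_peak_pref[OF assms(1)] by (simp add: dip_pref_def)
  show "\<exists>\<delta>\<in>X. \<forall>x\<in>X. \<forall>y\<in>X. \<delta> \<ge> x \<and> x > y \<or> \<delta> \<le> x \<and> x < y \<longrightarrow> strict_part (dip_pref X u z) y x"
    by (rule bexI[OF _ assms(2)])
      (use assms(1) in \<open>auto simp: dip_pref_def peak_pref_def strict_part_def opposite_def\<close>)
qed

lemma in_dip_pref:
  "(x, y) \<in> dip_pref X u z \<Longrightarrow> (if u y \<le> u z then u x \<le> u y \<or> u z < u x else u y \<le> u x)"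
  by (simp add: dip_pref_def peak_pref_def)

lemma in_peak_pref:
  "(x, y) \<in> peak_pref X u z \<Longrightarrow> (if u x \<le> u z then u y \<le> u x \<or> u z < u y else u x \<le> u y)"
  by (simp add: peak_pref_def)

lemma bottom_dip_pref:
  assumes "opposite u v" "(z, y) \<in> dip_pref X u z"
  shows "y = z"
proof -
  have "u y = u z" using in_dip_pref[OF assms(2)] by (auto split: if_splits)
  then show ?thesis by (simp add: opposite_inj[OF assms(1)])
qed

text \<open>If \<open>z\<close> beats something on its left, the dip lies to the left of \<open>z\<close>.\<close>

lemma single_dippedD:
  assumes R: "R \<in> single_dipped X" and X: "w \<in> X" "z \<in> X" "y \<in> X"
    and "w < z" "z < y" "(z, w) \<in> R"
  shows "(z, y) \<notin> R"
proof -
  obtain d where d: "\<And>x y. x \<in> X \<Longrightarrow> y \<in> X \<Longrightarrow> d \<ge> x \<and> x > y \<or> d \<le> x \<and> x < y \<Longrightarrow> strict_part R y x"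
    using R unfolding single_dipped_def by blast
  have "\<not> z \<le> d"
    using d[of z w] X assms(5,7) by (auto simp: strict_part_def)
  then show ?thesis
    using d[of z y] X assms(6) by (auto simp: strict_part_def)
qed

section \<open>Best elements of a closed set\<close>

lemma closed_max_below:
  fixes S :: "real set"
  assumes "closed S" "a \<in> S" "a \<le> b"
  obtains l where "l \<in> S" "l \<le> b" "\<And>x. x \<in> S \<Longrightarrow> x \<le> b \<Longrightarrow> x \<le> l"
proof -
  have "compact (S \<inter> {a..b})"
    using compact_Int_closed[OF compact_Icc assms(1)] by (simp add: Int_commute)
  moreover have "S \<inter> {a..b} \<noteq> {}" using assms by auto
  ultimately obtain l where l: "l \<in> S \<inter> {a..b}" "\<forall>x\<in>S \<inter> {a..b}. x \<le> l"
    using compact_attains_sup by blast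
  have "x \<le> l" if "x \<in> S" "x \<le> b" for x
    using l that by (cases "a \<le> x") auto
  with l that show thesis by auto
qed

lemma closed_min_above:
  fixes S :: "real set"
  assumes "closed S" "a \<in> S" "b \<le> a"
  obtains l where "l \<in> S" "b \<le> l" "\<And>x. x \<in> S \<Longrightarrow> b \<le> x \<Longrightarrow> l \<le> x"
proof -
  have "compact (S \<inter> {b..a})"
    using compact_Int_closed[OF compact_Icc assms(1)] by (simp add: Int_commute)
  moreover have "S \<inter> {b..a} \<noteq> {}" using assms by auto
  ultimately obtain l where l: "l \<in> S \<inter> {b..a}" "\<forall>x\<in>S \<inter> {b..a}. l \<le> x"
    using compact_attains_inf by blast
  have "l \<le> x" if "x \<in> S" "b \<le> x" for x
    using l that by (cases "x \<le> a") auto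
  with l that show thesis by auto
qed

text \<open>The peak of \<open>R\<close> may lie outside \<open>S\<close>. Closedness supplies the
  element of \<open>S\<close> nearest to the peak on each side that meets \<open>S\<close>; it beats
  its own side, and the better of the two is best.\<close>

lemma best_single_peaked:
  assumes R: "R \<in> single_peaked X" and S: "closed S" "S \<noteq> {}" "S \<subseteq> X"
  shows "best S R \<in> S" "\<And>y. y \<in> S \<Longrightarrow> (best S R, y) \<in> R"
proof -
  have lin: "linear_order_on X R" using R by (simp add: single_peaked_def)
  obtain p where p: "\<And>x y. x \<in> X \<Longrightarrow> y \<in> X \<Longrightarrow> p \<ge> x \<and> x > y \<or> p \<le> x \<and> x < y \<Longrightarrow> strict_part R x y"
    using R unfolding single_peaked_def by blast
  have refl: "(x, x) \<in> R" if "x \<in> X" for x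
    using lin that by (auto simp: order_on_defs refl_on_def)
  have tot: "(x, y) \<in> R \<or> (y, x) \<in> R" if "x \<in> X" "y \<in> X" for x y
    using lin that refl[OF that(1)] by (cases "x = y") (auto simp: order_on_defs total_on_def)
  have tr: "(x, y) \<in> R \<Longrightarrow> (y, w) \<in> R \<Longrightarrow> (x, w) \<in> R" for x y w
    using lin by (auto simp: order_on_defs dest: transD)
  have asym: "(x, y) \<in> R \<Longrightarrow> (y, x) \<in> R \<Longrightarrow> x = y" for x y
    using lin by (auto simp: order_on_defs dest: antisymD)
  have left: "\<exists>l\<in>S. \<forall>y\<in>S. y \<le> p \<longrightarrow> (l, y) \<in> R" if a: "\<exists>a\<in>S. a \<le> p"
  proof -
    obtain l where l: "l \<in> S" "l \<le> p" "\<And>x. x \<in> S \<Longrightarrow> x \<le> p \<Longrightarrow> x \<le> l"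
      by (rule bexE[OF a]) (use closed_max_below[OF S(1)] in blast)
    have "(l, y) \<in> R" if y: "y \<in> S" "y \<le> p" for y
    proof (cases "y = l")
      case False
      with l(3)[OF y] have "y < l" by simp
      with p[of l y] l(1,2) y S(3) show ?thesis by (auto simp: strict_part_def)
    qed (use refl l(1) S(3) in auto)
    with l show ?thesis by blast
  qed
  have right: "\<exists>l\<in>S. \<forall>y\<in>S. p \<le> y \<longrightarrow> (l, y) \<in> R" if a: "\<exists>a\<in>S. p \<le> a"
  proof -
    obtain l where l: "l \<in> S" "p \<le> l" "\<And>x. x \<in> S \<Longrightarrow> p \<le> x \<Longrightarrow> l \<le> x"
      by (rule bexE[OF a]) (use closed_min_above[OF S(1)] in blast)
    have "(l, y) \<in> R" if y: "y \<in> S" "p \<le> y" for y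
    proof (cases "y = l")
      case False
      with l(3)[OF y] have "l < y" by simp
      with p[of l y] l(1,2) y S(3) show ?thesis by (auto simp: strict_part_def)
    qed (use refl l(1) S(3) in auto)
    with l show ?thesis by blast
  qed
  have "\<exists>x\<in>S. \<forall>y\<in>S. (x, y) \<in> R"
  proof (cases "(\<exists>a\<in>S. a \<le> p) \<and> (\<exists>a\<in>S. p \<le> a)")
    case True
    obtain l where l: "l \<in> S" "\<And>y. y \<in> S \<Longrightarrow> y \<le> p \<Longrightarrow> (l, y) \<in> R" using left True by blast
    obtain r where r: "r \<in> S" "\<And>y. y \<in> S \<Longrightarrow> p \<le> y \<Longrightarrow> (r, y) \<in> R" using right True by blast
    have "(l, r) \<in> R \<or> (r, l) \<in> R" using tot l(1) r(1) S(3) by blast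
    then show ?thesis
    proof
      assume lr: "(l, r) \<in> R"
      have "(l, y) \<in> R" if "y \<in> S" for y
        using l(2)[OF that] tr[OF lr r(2)[OF that]] by linarith
      with l(1) show ?thesis by blast
    next
      assume rl: "(r, l) \<in> R"
      have "(r, y) \<in> R" if "y \<in> S" for y
        using r(2)[OF that] tr[OF rl l(2)[OF that]] by linarith
      with r(1) show ?thesis by blast
    qed
  next
    case False
    obtain a where a: "a \<in> S" using S(2) by blast
    show ?thesis
    proof (cases "a \<le> p")
      case True
      with False a have "\<forall>y\<in>S. y \<le> p" by force
      with left True a show ?thesis by blast
    next
      case F: False
      with False a have "\<forall>y\<in>S. p \<le> y" by force
      with right F a show ?thesis by force
    qed
  qed
  then obtain x where x: "x \<in> S" "\<forall>y\<in>S. (x, y) \<in> R" by blast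
  have "best S R = x"
    unfolding best_def using x asym by (intro the_equality) auto
  with x show "best S R \<in> S" "\<And>y. y \<in> S \<Longrightarrow> (best S R, y) \<in> R" by auto
qed

text \<open>If \<open>x\<close> is not itself best and the peak lay beyond \<open>x\<close>, then
  \<open>x\<close> would lie between the best element and the peak and beat the former. So the peak
  is at or before \<open>x\<close>, and preference falls from \<open>x\<close> to
  \<open>y\<close>.\<close>

lemma single_peakedD:
  assumes R: "R \<in> single_peaked X" and S: "closed S" "S \<noteq> {}" "S \<subseteq> X"
    and u: "opposite u v" and xy: "x \<in> S" "y \<in> S" "u (best S R) \<le> u x" "u x < u y"
  shows "(y, x) \<notin> R"
proof
  assume yx: "(y, x) \<in> R"
  have asym: "(x, y) \<in> R \<Longrightarrow> (y, x) \<in> R \<Longrightarrow> x = y" for x y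
    using R by (auto simp: single_peaked_def order_on_defs dest: antisymD)
  obtain p where p: "\<And>x y. x \<in> X \<Longrightarrow> y \<in> X \<Longrightarrow> p \<ge> x \<and> x > y \<or> p \<le> x \<and> x < y \<Longrightarrow> strict_part R x y"
    using R unfolding single_peaked_def by blast
  note b = best_single_peaked[OF R S]
  show False
  proof (cases "u (best S R) = u x")
    case True
    then have "best S R = x" by (simp add: opposite_inj[OF u])
    then have "x = y" using b(2)[OF xy(2)] yx asym by blast
    with xy(4) show False by simp
  next
    case False
    then have bx: "u (best S R) < u x" using xy(3) by simp
    show False
    proof (cases "u p \<le> u x")
      case True
      then have "strict_part R x y"
        using p[of x y] xy u subsetD[OF S(3)] by (auto simp: opposite_def)
      with yx show False by (simp add: strict_part_def)
    next
      case False
      then have "strict_part R x (best S R)"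
        using p[of x "best S R"] bx xy(1) b(1) u subsetD[OF S(3)] by (auto simp: opposite_def)
      with b(2)[OF xy(1)] show False by (simp add: strict_part_def)
    qed
  qed
qed

lemma best_peak_pref:
  assumes u: "opposite u v" and S: "z \<in> S" "S \<subseteq> X"
  shows "best S (peak_pref X u z) = z"
  unfolding best_def
proof (rule the_equality)
  show "z \<in> S \<and> (\<forall>y\<in>S. (z, y) \<in> peak_pref X u z)"
    using S by (auto simp: peak_pref_def)
next
  fix x assume "x \<in> S \<and> (\<forall>y\<in>S. (x, y) \<in> peak_pref X u z)"
  then have "(x, z) \<in> peak_pref X u z" using S by blast
  from in_peak_pref[OF this] have "u x = u z"
    by (auto split: if_splits)
  then show "x = z" by (simp add: opposite_inj[OF u])
qed

subsection \<open>Replacing preferences\<close>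

locale sp_rule =
  fixes X \<Omega> :: "real set" and n :: nat and A :: "nat set"
    and f :: "(nat \<Rightarrow> real rel) \<Rightarrow> real"
  assumes agents: "A \<subseteq> {1..n}"
    and rule: "f \<in> profiles X n A \<rightarrow> X"
    and range: "\<Omega> = f ` profiles X n A"
    and complement_open: "open (- \<Omega>)"
    and two: "\<exists>x\<in>\<Omega>. \<exists>y\<in>\<Omega>. x \<noteq> y"
    and SP: "strategy_proof X n A f"
begin

abbreviation "Profs \<equiv> profiles X n A"
abbreviation "Peaked z \<equiv> {R \<in> Profs. \<forall>i\<in>A. best \<Omega> (R i) = z}"

text \<open>The restriction gives the default value outside \<open>{1..n}\<close> that the
  extensional product \<open>profiles\<close> demands.\<close>

definition profile :: "(nat \<Rightarrow> real rel) \<Rightarrow> (nat \<Rightarrow> real rel) \<Rightarrow> nat \<Rightarrow> real rel" where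
  "profile a d = (\<lambda>i\<in>{1..n}. if i \<in> A then a i else d i)"

lemma range_subset: "\<Omega> \<subseteq> X"
  using rule range by blast

lemma range_in_X: "x \<in> \<Omega> \<Longrightarrow> x \<in> X"
  using range_subset by blast

lemma closed_range: "closed \<Omega>"
  using complement_open by (simp add: closed_def)

lemma range_nonempty: "\<Omega> \<noteq> {}"
  using two by blast

lemma outcome: "R \<in> Profs \<Longrightarrow> f R \<in> \<Omega>"
  using range by blast

lemma single_peaked_profile: "R \<in> Profs \<Longrightarrow> i \<in> A \<Longrightarrow> R i \<in> single_peaked X"
  using agents unfolding profiles_def prefs_def by (auto dest!: PiE_mem[of _ _ _ i])

lemma single_dipped_profile: "R \<in> Profs \<Longrightarrow> i \<in> {1..n} - A \<Longrightarrow> R i \<in> single_dipped X"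
  unfolding profiles_def prefs_def by (auto dest!: PiE_mem[of _ _ _ i])

lemma linear_prefs: "R \<in> prefs X A i \<Longrightarrow> linear_order_on X R"
  by (auto simp: prefs_def single_peaked_def single_dipped_def split: if_splits)

lemma antisym_profile:
  assumes "R \<in> Profs" "i \<in> {1..n}" "(x, y) \<in> R i" "(y, x) \<in> R i"
  shows "x = y"
proof -
  have "linear_order_on X (R i)"
    using assms(1,2) by (intro linear_prefs[of _ i]) (auto simp: profiles_def)
  with assms(3,4) show ?thesis by (auto simp: order_on_defs dest: antisymD)
qed

lemma best_best: "R \<in> Profs \<Longrightarrow> i \<in> A \<Longrightarrow> y \<in> \<Omega> \<Longrightarrow> (best \<Omega> (R i), y) \<in> R i"
  using best_single_peaked(2)[OF single_peaked_profile closed_range range_nonempty range_subset] .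

lemma best_unique:
  "R \<in> Profs \<Longrightarrow> i \<in> A \<Longrightarrow> y \<in> \<Omega> \<Longrightarrow> (y, best \<Omega> (R i)) \<in> R i \<Longrightarrow> y = best \<Omega> (R i)"
  using best_best antisym_profile agents by blast

lemma peakedD:
  assumes "opposite u v" "R \<in> Profs" "i \<in> A" "x \<in> \<Omega>" "y \<in> \<Omega>"
    "u (best \<Omega> (R i)) \<le> u x" "(y, x) \<in> R i"
  shows "u y \<le> u x"
  using single_peakedD[OF single_peaked_profile[OF assms(2,3)] closed_range range_nonempty
      range_subset assms(1,4,5,6)] assms(7) by force

lemma SP_step:
  assumes "R \<in> Profs" "i \<in> {1..n}" "R' \<in> prefs X A i"
  shows "(f R, f (R(i := R'))) \<in> R i"
proof -
  have up: "R(i := R') \<in> Profs"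
    using assms unfolding profiles_def by (auto simp: PiE_def extensional_def)
  have lin: "linear_order_on X (R i)"
    using assms(1,2) by (intro linear_prefs[of _ i]) (auto simp: profiles_def)
  have X: "f R \<in> X" "f (R(i := R')) \<in> X"
    using outcome[OF assms(1)] outcome[OF up] range_subset by auto
  have "\<not> strict_part (R i) (f (R(i := R'))) (f R)"
    using SP assms unfolding strategy_proof_def by blast
  then show ?thesis
    using lin X unfolding strict_part_def order_on_defs total_on_def refl_on_def
    by (cases "f R = f (R(i := R'))") auto
qed

text \<open>
  An invariant of the outcome need only be checked for the replacement of a single preference: by
  strategy-proofness the old outcome \<open>x\<close> is weakly better in the old preference, and the new outcome
  \<open>y\<close> in the new one.
\<close>

lemma change_prefs:
  assumes R: "R \<in> Profs" and R': "R' \<in> Profs" and init: "P (f R)"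
    and step: "\<And>i x y. i \<in> {1..n} \<Longrightarrow> R i \<noteq> R' i \<Longrightarrow> x \<in> \<Omega> \<Longrightarrow> y \<in> \<Omega> \<Longrightarrow> P x \<Longrightarrow>
      (x, y) \<in> R i \<Longrightarrow> (y, x) \<in> R' i \<Longrightarrow> P y"
  shows "P (f R')"
proof -
  have *: "override_on R R' F \<in> Profs" for F
    using R R' unfolding profiles_def override_on_def
    by (intro PiE_I) (auto simp del: atLeastAtMost_iff dest: PiE_mem PiE_arb)
  have "P (f (override_on R R' F))" if "finite F" "F \<subseteq> {1..n}" for F
    using that
  proof (induction F rule: finite_induct)
    case empty
    then show ?case using init by simp
  next
    case (insert i F)
    let ?Q = "override_on R R' F" and ?Q' = "override_on R R' (insert i F)"
    have i: "i \<in> {1..n}" and Q: "P (f ?Q)" using insert by auto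
    have eq: "?Q' = ?Q(i := R' i)" "?Q = ?Q'(i := R i)" "?Q i = R i" "?Q' i = R' i"
      using insert.hyps(2) by (auto simp: override_on_def fun_eq_iff)
    show ?case
    proof (cases "R i = R' i")
      case True
      then have "?Q' = ?Q" by (auto simp: override_on_def fun_eq_iff)
      then show ?thesis using Q by simp
    next
      case False
      have prefs: "R i \<in> prefs X A i" "R' i \<in> prefs X A i"
        using R R' i unfolding profiles_def by (blast dest: PiE_mem)+
      \<comment> \<open>Agent \<open>i\<close> gains neither by leaving \<open>R i\<close> nor by
        returning to it from \<open>R' i\<close>.\<close>
      have "(f ?Q, f ?Q') \<in> R i"
        using SP_step[OF *[of F] i prefs(2)] by (simp only: eq(1,3))
      moreover have "(f ?Q', f ?Q) \<in> R' i"
        using SP_step[OF *[of "insert i F"] i prefs(1)] by (simp only: eq(2,4))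
      ultimately show ?thesis
        using step[OF i False outcome[OF *] outcome[OF *] Q] by blast
    qed
  qed
  from this[of "{1..n}"] have "P (f (override_on R R' {1..n}))" by simp
  moreover have "override_on R R' {1..n} = R'"
    using R R' unfolding profiles_def override_on_def fun_eq_iff by (metis PiE_arb)
  ultimately show ?thesis by simp
qed

text \<open>The new outcome is weakly better than \<open>z\<close> in the new preference, so an
  agent of \<open>A\<close> who ends with \<open>z\<close> on top leaves only \<open>z\<close>. For
  the other agents the exclusion is the hypothesis \<open>dipped\<close>; it holds, for instance,
  when \<open>z\<close> is at the bottom of the old preference.\<close>

lemma keep_outcome:
  assumes R: "R \<in> Profs" and R': "R' \<in> Profs" and "f R = z"
    and peaked: "\<And>i. i \<in> A \<Longrightarrow> R i \<noteq> R' i \<Longrightarrow> best \<Omega> (R' i) = z"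
    and dipped: "\<And>i y. i \<in> {1..n} - A \<Longrightarrow> y \<in> \<Omega> \<Longrightarrow> R i \<noteq> R' i \<Longrightarrow>
      (z, y) \<in> R i \<Longrightarrow> (y, z) \<in> R' i \<Longrightarrow> y = z"
  shows "f R' = z"
proof (rule change_prefs[OF R R', where P = "\<lambda>y. y = z"])
  fix i x y
  assume i: "i \<in> {1..n}" and "R i \<noteq> R' i" "x \<in> \<Omega>" "y \<in> \<Omega>" "x = z" "(x, y) \<in> R i" "(y, x) \<in> R' i"
  then show "y = z"
    using peaked[of i] dipped[of i y] best_unique[OF R', of i y] by (cases "i \<in> A") auto
qed (rule assms(3))

lemma profile_in:
  assumes "\<And>i. i \<in> A \<Longrightarrow> a i \<in> single_peaked X"
    and "\<And>i. i \<in> {1..n} - A \<Longrightarrow> d i \<in> single_dipped X"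
  shows "profile a d \<in> Profs"
  using assms unfolding profile_def profiles_def prefs_def by auto

lemma profile_A: "i \<in> A \<Longrightarrow> profile a d i = a i"
  using agents by (auto simp: profile_def)

lemma profile_D: "i \<in> {1..n} - A \<Longrightarrow> profile a d i = d i"
  by (auto simp: profile_def)

lemma peak_pref_mem: "opposite u v \<Longrightarrow> z \<in> \<Omega> \<Longrightarrow> peak_pref X u z \<in> single_peaked X"
  using peak_pref_single_peaked range_in_X by blast

lemma dip_pref_mem: "opposite u v \<Longrightarrow> z \<in> \<Omega> \<Longrightarrow> dip_pref X u z \<in> single_dipped X"
  using dip_pref_single_dipped range_in_X by blast

lemma best_peak: "opposite u v \<Longrightarrow> z \<in> \<Omega> \<Longrightarrow> best \<Omega> (peak_pref X u z) = z"
  using best_peak_pref range_subset by blast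

subsection \<open>Unanimity\<close>

text \<open>Start from outcome \<open>M\<close>. Dipped agents who turn to favouring the
  \<open>u\<close>-right of \<open>z\<close> keep the outcome strictly right; agents of
  \<open>A\<close> who do likewise may then drag it to their top \<open>z\<close>, but no
  further.\<close>

lemma favour_side:
  assumes uv: "opposite u v" and z: "z \<in> \<Omega>" "M \<in> \<Omega>" "u z < u M"
  shows "u z \<le> u (f (profile (\<lambda>_. peak_pref X v z) (\<lambda>_. dip_pref X u z)))"
proof -
  note vu = opposite_sym[OF uv]
  obtain R where R: "R \<in> Profs" "f R = M" using range z by auto
  let ?Q = "profile R (\<lambda>_. dip_pref X u z)"
    and ?Q' = "profile (\<lambda>_. peak_pref X v z) (\<lambda>_. dip_pref X u z)"
  have Q: "?Q \<in> Profs" "?Q' \<in> Profs"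
    using single_peaked_profile[OF R(1)] peak_pref_mem[OF vu z(1)] dip_pref_mem[OF uv z(1)] by (auto intro!: profile_in)
  have "u z < u (f ?Q)"
  proof (rule change_prefs[OF R(1) Q(1)])
    fix i x y assume "i \<in> {1..n}" "R i \<noteq> ?Q i" "u z < u x" "(y, x) \<in> ?Q i"
    then show "u z < u y"
      using profile_A[of i] profile_D[of i] in_dip_pref[of y x X u z]
      by (cases "i \<in> A") (auto split: if_splits)
  qed (use R z in simp)
  then have "u z \<le> u (f ?Q)" by simp
  then show ?thesis
  proof (rule change_prefs[OF Q, where P = "\<lambda>x. u z \<le> u x"])
    fix i x y assume "i \<in> {1..n}" "?Q i \<noteq> ?Q' i" "u z \<le> u x" "(y, x) \<in> ?Q' i"
    then show "u z \<le> u y"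
      using profile_A[of i] profile_D[of i] in_peak_pref[of y x X v z] opposite_neg[OF uv]
      by (cases "i \<in> A") (auto split: if_splits)
  qed
qed

lemma unanimity_from_bottom:
  assumes Q: "Q \<in> Profs" "f Q = z"
    and bottom: "\<And>i y. i \<in> {1..n} - A \<Longrightarrow> (z, y) \<in> Q i \<Longrightarrow> y = z"
    and R: "R \<in> Peaked z"
  shows "f R = z"
  by (rule keep_outcome[OF Q(1) _ Q(2)]) (use R bottom in auto)

text \<open>
  The dipped agents are split into those (in \<open>S\<close>) who rank \<open>z\<close> above everything \<open>u\<close>-left of it and those
  who rank it above everything \<open>u\<close>-right of it. The assumption \<open>less\<close> forces the outcome \<open>z\<close> to survive
  when the second group puts \<open>z\<close> at the bottom, after which that group is irrelevant.
\<close>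

lemma unanimity_half:
  assumes uv: "opposite u v" and z: "z \<in> \<Omega>" "m \<in> \<Omega>" "M \<in> \<Omega>" "u m < u z" "u z < u M"
    and a: "\<And>i. i \<in> A \<Longrightarrow> a i \<in> single_peaked X"
    and init: "f (profile a (\<lambda>i. if i \<in> S then dip_pref X u m else dip_pref X v M)) = z"
    and less: "u (f (profile a (\<lambda>i. if i \<in> S then dip_pref X u z else dip_pref X v z))) < u z"
    and R: "R \<in> Peaked z"
  shows "f R = z"
proof -
  note vu = opposite_sym[OF uv]
  let ?b = "\<lambda>_::nat. peak_pref X v z"
  let ?P = "\<lambda>a s t. profile a (\<lambda>i. if i \<in> S then s else t)"
  let ?um = "dip_pref X u m" and ?uz = "dip_pref X u z"
    and ?vM = "dip_pref X v M" and ?vz = "dip_pref X v z"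
  note neg = opposite_neg[OF uv]
  note pref = peak_pref_mem[OF vu] dip_pref_mem[OF uv] dip_pref_mem[OF vu] z
  have in_P: "?P a s t \<in> Profs" "?P ?b s t \<in> Profs"
    if "s \<in> single_dipped X" "t \<in> single_dipped X" for s t
    using that pref a by (auto intro!: profile_in)
  have D: "(if i \<in> S then s \<noteq> s' else t \<noteq> t') \<and>
      ?P c s t i = (if i \<in> S then s else t) \<and> ?P c s' t' i = (if i \<in> S then s' else t')"
    if "i \<in> {1..n}" "?P c s t i \<noteq> ?P c s' t' i" for i c s t s' t'
    using that by (auto simp: profile_def split: if_splits)
  \<comment> \<open>On the \<open>u\<close>-left of \<open>M\<close>, \<open>dip_pref X v M\<close>
    falls to the right; an agent leaving it cannot carry the outcome from \<open>z\<close> or its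
    right to the left of \<open>z\<close>.\<close>
  have P1: "u z \<le> u (f (?P a ?um ?vz))"
  proof (rule change_prefs[where P = "\<lambda>x. u z \<le> u x" and R = "?P a ?um ?vM"])
    fix i x y assume i: "i \<in> {1..n}" "?P a ?um ?vM i \<noteq> ?P a ?um ?vz i"
      and x: "u z \<le> u x" and xy: "(x, y) \<in> ?P a ?um ?vM i"
    have "(x, y) \<in> ?vM" using D[OF i] xy by (auto split: if_splits)
    then show "u z \<le> u y"
      using in_dip_pref[of x y X v M] x z neg by (auto split: if_splits)
  qed (use in_P pref init in auto)
  \<comment> \<open>Otherwise the agents in \<open>S\<close>, turning to \<open>?uz\<close>, would
    keep the outcome strictly right of \<open>z\<close>, against \<open>less\<close>.\<close>
  have "\<not> u z < u (f (?P a ?um ?vz))"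
  proof
    assume gt: "u z < u (f (?P a ?um ?vz))"
    have "u z < u (f (?P a ?uz ?vz))"
    proof (rule change_prefs[where P = "\<lambda>x. u z < u x" and R = "?P a ?um ?vz"])
      fix i x y assume i: "i \<in> {1..n}" "?P a ?um ?vz i \<noteq> ?P a ?uz ?vz i"
        and x: "u z < u x" and xy: "(y, x) \<in> ?P a ?uz ?vz i"
      have "(y, x) \<in> ?uz" using D[OF i] xy by (auto split: if_splits)
      then show "u z < u y"
        using in_dip_pref[of y x X u z] x by (auto split: if_splits)
    qed (use in_P pref gt in auto)
    with less show False by simp
  qed
  with P1 have eq: "f (?P a ?um ?vz) = z"
    using opposite_inj[OF uv] by force
  \<comment> \<open>The dipped agents outside \<open>S\<close> now have \<open>z\<close> at the
    bottom, so they can be reversed to \<open>?uz\<close> while the agents of \<open>A\<close> put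
    \<open>z\<close> on top.\<close>
  have "f (?P ?b ?um ?uz) = z"
  proof (rule keep_outcome[OF _ _ eq])
    fix i y assume i: "i \<in> {1..n} - A" "?P a ?um ?vz i \<noteq> ?P ?b ?um ?uz i"
      and zy: "(z, y) \<in> ?P a ?um ?vz i"
    have "(z, y) \<in> ?vz" using i zy by (auto simp: profile_D split: if_splits)
    then show "y = z" by (rule bottom_dip_pref[OF vu])
  qed (use in_P pref in \<open>auto simp: profile_A best_peak[OF vu]\<close>)
  then have "u (f (?P ?b ?um ?uz)) \<le> u z" by simp
  \<comment> \<open>Turning the agents in \<open>S\<close> as well cannot carry the outcome right of
    \<open>z\<close>; \<open>favour_side\<close> excludes the left.\<close>
  then have "u (f (?P ?b ?uz ?uz)) \<le> u z"
  proof (rule change_prefs[where P = "\<lambda>x. u x \<le> u z", rotated 2])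
    fix i x y assume i: "i \<in> {1..n}" "?P ?b ?um ?uz i \<noteq> ?P ?b ?uz ?uz i"
      and x: "u x \<le> u z" and xy: "(x, y) \<in> ?P ?b ?um ?uz i"
    have "(x, y) \<in> ?um" using D[OF i] xy by (auto split: if_splits)
    then show "u y \<le> u z"
      using in_dip_pref[of x y X u m] x z by (auto split: if_splits)
  qed (intro in_P pref)+
  then have "f (?P ?b ?uz ?uz) = z"
    using favour_side[OF uv z(1,3,5)] opposite_inj[OF uv] by force
  with in_P(2)[of ?uz ?uz] pref show ?thesis
    by (intro unanimity_from_bottom[OF _ _ _ R])
      (auto simp: profile_D intro: bottom_dip_pref[OF uv])
qed

text \<open>In a profile with outcome \<open>z\<close>, each dipped agent can adopt one of two
  extremal preferences without changing the outcome. Next, \<open>?B\<close> has \<open>z\<close> at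
  the bottom for all dipped agents. Its outcome is \<open>z\<close>, which suffices, or it is on one
  side of \<open>z\<close>, which is the hypothesis \<open>less\<close> of
  \<open>unanimity_half\<close> in one of the two orientations.\<close>

lemma unanimity:
  assumes z: "m \<in> \<Omega>" "z \<in> \<Omega>" "M \<in> \<Omega>" "m < z" "z < M" and R: "R \<in> Peaked z"
  shows "f R = z"
proof -
  let ?I = "\<lambda>x::real. x" and ?N = "uminus :: real \<Rightarrow> real"
  note o = opposite_id opposite_sym[OF opposite_id]
  obtain R0 where R0: "R0 \<in> Profs" "f R0 = z" using range z(2) by auto
  \<comment> \<open>A dipped agent in \<open>S\<close> ranks \<open>z\<close> below everything right
    of it, one outside \<open>S\<close> below every alternative of \<Omega> left of it. The new
    preference puts only alternatives of that side above \<open>z\<close>, so no other outcome is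
    both worse than \<open>z\<close> before and better after.\<close>
  define S where "S = {i. \<exists>w\<in>\<Omega>. w < z \<and> (z, w) \<in> R0 i}"
  let ?a = "\<lambda>_::nat. peak_pref X ?I z"
  let ?Q = "profile ?a (\<lambda>i. if i \<in> S then dip_pref X ?I m else dip_pref X ?N M)"
  let ?B = "profile ?a (\<lambda>i. if i \<in> S then dip_pref X ?I z else dip_pref X ?N z)"
  note pref = peak_pref_mem[OF o(1)] dip_pref_mem[OF o(1)] dip_pref_mem[OF o(2)] z
  have Q: "f ?Q = z"
  proof (rule keep_outcome[OF R0(1) _ R0(2)])
    fix i y assume i: "i \<in> {1..n} - A" and y: "y \<in> \<Omega>" "(z, y) \<in> R0 i" "(y, z) \<in> ?Q i"
    show "y = z"
    proof (cases "i \<in> S")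
      case True
      then obtain w where w: "w \<in> \<Omega>" "w < z" "(z, w) \<in> R0 i" by (auto simp: S_def)
      have "(y, z) \<in> dip_pref X ?I m" using y(3) i True by (simp add: profile_D)
      then have "z \<le> y" using in_dip_pref[of y z X ?I m] z by (auto split: if_splits)
      moreover have "\<not> z < y"
        using single_dippedD[OF single_dipped_profile[OF R0(1) i], of w z y] w y z range_in_X by auto
      ultimately show ?thesis by simp
    next
      case False
      have "(y, z) \<in> dip_pref X ?N M" using y(3) i False by (simp add: profile_D)
      then have "y \<le> z" using in_dip_pref[of y z X ?N M] z by (auto split: if_splits)
      moreover have "\<not> y < z" using False y by (auto simp: S_def)
      ultimately show ?thesis by simp
    qed
  qed (use pref in \<open>auto intro!: profile_in simp: profile_A best_peak[OF o(1)]\<close>)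
  consider "f ?B = z" | "f ?B < z" | "- f ?B < - z" by linarith
  then show ?thesis
  proof cases
    case 1
    then show ?thesis
      by (rule unanimity_from_bottom[rotated, OF _ _ R])
        (use pref bottom_dip_pref[OF o(1)] bottom_dip_pref[OF o(2)] in
          \<open>auto intro!: profile_in simp: profile_D split: if_splits\<close>)
  next
    case 2
    show ?thesis
      by (rule unanimity_half[OF o(1) z(2,1,3) _ _ _ Q 2 R]) (use pref in auto)
  next
    case 3
    \<comment> \<open>Reversing the orientation exchanges the two groups, and \<open>m\<close> with
      \<open>M\<close>.\<close>
    have swap: "(\<lambda>i. if i \<in> - S then b else c) = (\<lambda>i. if i \<in> S then c else b)"
      for b c :: "real rel" by (rule ext) simp
    show ?thesis
      by (rule unanimity_half[OF o(2) z(2,3,1), where a = ?a and S = "- S"])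
        (use pref Q 3 R in \<open>auto simp only: swap neg_less_iff_less\<close>)
  qed
qed

subsection \<open>Dependence of the outcome on the tops\<close>

text \<open>If the outcome were left of \<open>z\<close>, the agents of \<open>A\<close> could adopt
  the top \<open>z\<close> with a bias to the left, and the outcome would stay strictly left: their
  old preferences rank \<open>z\<close> above it. This contradicts unanimity at \<open>z\<close>,
  which lies between the outcome and \<open>M\<close>.\<close>

lemma best_ge_outcome_ge:
  assumes uv: "opposite u v" and z: "z \<in> \<Omega>" "M \<in> \<Omega>" "u z < u M"
    and R: "R \<in> Profs" "\<And>i. i \<in> A \<Longrightarrow> u z \<le> u (best \<Omega> (R i))"
  shows "u z \<le> u (f R)"
proof (rule ccontr)
  assume lt: "\<not> u z \<le> u (f R)"
  note vu = opposite_sym[OF uv]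
  let ?Q = "profile (\<lambda>_. peak_pref X u z) R"
  have Q: "?Q \<in> Profs"
    using peak_pref_mem[OF uv z(1)] single_dipped_profile[OF R(1)] by (intro profile_in)
  have "u (f ?Q) < u z"
  proof (rule change_prefs[OF R(1) Q])
    fix i x y assume i: "i \<in> {1..n}" "R i \<noteq> ?Q i" "x \<in> \<Omega>" "y \<in> \<Omega>" "u x < u z"
      "(x, y) \<in> R i" "(y, x) \<in> ?Q i"
    then have A: "i \<in> A" using profile_D[of i _ R] by auto
    have yx: "u x \<le> u y" "u y \<le> u z"
      using i profile_A[OF A] in_peak_pref[of y x X u z] by (auto split: if_splits)
    have "u y \<noteq> u z"
    proof
      assume "u y = u z"
      then have "y = z" by (simp add: opposite_inj[OF uv])
      with i have xz: "(x, z) \<in> R i" by simp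
      show False
        using peakedD[OF vu R(1) A z(1) i(3) _ xz] R(2)[OF A] i(5) opposite_neg[OF uv] by simp
    qed
    with yx show "u y < u z" by simp
  qed (use lt in simp)
  moreover have "f ?Q = z"
  proof -
    have "?Q \<in> Peaked z" using Q by (simp add: profile_A best_peak[OF uv z(1)])
    moreover have "f R < z \<and> z < M \<or> M < z \<and> z < f R"
      using uv lt z by (auto simp: opposite_def)
    ultimately show ?thesis
      using unanimity[of "f R" z M ?Q] unanimity[of M z "f R" ?Q] outcome[OF R(1)] z by blast
  qed
  ultimately show False by simp
qed


text \<open>A chain of profiles passes through one with outcome exactly \<open>z\<close>. There the
  agents with top \<open>z\<close> can turn from favouring the left to favouring the right without
  changing the outcome, which makes the comparison with \<open>R\<close> possible. The dipped agents
  keep their preferences from \<open>R\<close> throughout.\<close>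

lemma outcome_le_mono:
  assumes uv: "opposite u v" and z: "z \<in> \<Omega>"
    and p: "\<And>i. i \<in> A \<Longrightarrow> p i \<in> \<Omega>"
    and low: "\<And>R. R \<in> Profs \<Longrightarrow> (\<And>i. i \<in> A \<Longrightarrow> best \<Omega> (R i) = p i) \<Longrightarrow> u (f R) \<le> u z"
    and R: "R \<in> Profs" "\<And>i. i \<in> A \<Longrightarrow> u (p i) \<le> u z \<Longrightarrow> u (best \<Omega> (R i)) \<le> u z"
  shows "u (f R) \<le> u z"
proof (cases "\<exists>M\<in>\<Omega>. u z < u M")
  case False
  then show ?thesis using outcome[OF R(1)] by force
next
  case True
  then obtain M where M: "M \<in> \<Omega>" "u z < u M" by blast
  note vu = opposite_sym[OF uv] and neg = opposite_neg[OF uv]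
  \<comment> \<open>\<open>L\<close> is read off from \<open>R\<close>, not from \<open>p\<close>:
    an agent of \<open>A\<close> outside \<open>L\<close> has its top right of \<open>z\<close> in
    both.\<close>
  define L where "L = {i. u (best \<Omega> (R i)) \<le> u z}"
  have pL: "u z < u (p i)" if "i \<in> A" "i \<notin> L" for i
    using R(2)[OF that(1)] that(2) by (force simp: L_def)
  let ?Q = "\<lambda>l r. profile (\<lambda>i. if i \<in> L then l i else r i) R"
  let ?lz = "\<lambda>_::nat. peak_pref X u z" and ?rz = "\<lambda>_::nat. peak_pref X v z"
    and ?p = "\<lambda>i. peak_pref X v (p i)"
  have in_Q: "?Q l r \<in> Profs" if "\<And>i. i \<in> A \<Longrightarrow> l i \<in> single_peaked X"
    "\<And>i. i \<in> A \<Longrightarrow> r i \<in> single_peaked X" for l r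
    using that single_dipped_profile[OF R(1)] by (auto intro!: profile_in)
  note pref = peak_pref_mem[OF uv z] peak_pref_mem[OF vu z] peak_pref_mem[OF vu p] single_peaked_profile[OF R(1)]
  have QA: "i \<in> A \<and> ?Q l r i = (if i \<in> L then l i else r i) \<and> ?Q l' r' i = (if i \<in> L then l' i else r' i)"
    if "?Q l r i \<noteq> ?Q l' r' i" for i l r l' r'
    using that by (auto simp: profile_def split: if_splits)
  have 1: "u (f (?Q ?p ?p)) \<le> u z"
    using in_Q[of ?p ?p] pref by (intro low) (auto simp: profile_A best_peak[OF vu p])
  have 2: "u (f (?Q ?lz ?p)) \<le> u z"
  proof (rule change_prefs[where P = "\<lambda>x. u x \<le> u z" and R = "?Q ?p ?p"])
    fix i x y assume i: "?Q ?p ?p i \<noteq> ?Q ?lz ?p i" and x: "u x \<le> u z" and yx: "(y, x) \<in> ?Q ?lz ?p i"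
    have "(y, x) \<in> peak_pref X u z" using QA[OF i] i yx by (auto split: if_splits)
    then show "u y \<le> u z" using in_peak_pref[of y x X u z] x by (auto split: if_splits)
  qed (use in_Q[of ?p ?p] in_Q[of ?lz ?p] pref 1 in auto)
  \<comment> \<open>Every top is now at \<open>z\<close> or right of it, which pins the outcome from
    the other side.\<close>
  have "u z \<le> u (f (?Q ?lz ?p))"
  proof (rule best_ge_outcome_ge[OF uv z M])
    show "u z \<le> u (best \<Omega> (?Q ?lz ?p i))" if "i \<in> A" for i
      using that pL[OF that] by (auto simp: profile_A best_peak[OF uv z] best_peak[OF vu p] less_imp_le)
  qed (use in_Q pref in auto)
  with 2 have "f (?Q ?lz ?p) = z" using opposite_inj[OF uv] by force
  then have "f (?Q ?rz ?p) = z"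
  proof (rule keep_outcome[rotated 2])
    show "best \<Omega> (?Q ?rz ?p i) = z" if "i \<in> A" "?Q ?lz ?p i \<noteq> ?Q ?rz ?p i" for i
      using that QA[OF that(2)] by (auto simp: best_peak[OF vu z])
    show "y = z" if "i \<in> {1..n} - A" "?Q ?lz ?p i \<noteq> ?Q ?rz ?p i" for i y
      using that by (auto simp: profile_D)
  qed (use in_Q pref in auto)
  then have "u (f (?Q ?rz ?p)) \<le> u z" by simp
  \<comment> \<open>In the preferences now abandoned, everything right of an outcome at or left of
    \<open>z\<close> is better; so the outcome can only move left.\<close>
  then have 3: "u (f (?Q ?rz R)) \<le> u z"
  proof (rule change_prefs[where P = "\<lambda>x. u x \<le> u z", rotated 2])
    fix i x y assume i: "?Q ?rz ?p i \<noteq> ?Q ?rz R i" and x: "u x \<le> u z" and xy: "(x, y) \<in> ?Q ?rz ?p i"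
    have iA: "i \<in> A" "i \<notin> L" and xy': "(x, y) \<in> peak_pref X v (p i)"
      using QA[OF i] i xy by (auto split: if_splits)
    show "u y \<le> u z"
      using in_peak_pref[OF xy'] pL[OF iA] x neg by (auto split: if_splits)
  qed (use in_Q pref in auto)
  show ?thesis
  proof (rule ccontr)
    assume "\<not> u (f R) \<le> u z"
    then have "u z < u (f R)" by simp
    \<comment> \<open>The agents in \<open>L\<close> cannot drag the outcome to \<open>z\<close>,
      since their preferences in \<open>R\<close> rank \<open>z\<close> above the outcome they
      leave.\<close>
    then have "u z < u (f (?Q ?rz R))"
    proof (rule change_prefs[where P = "\<lambda>x. u z < u x", rotated 2])
      fix i x y assume i: "i \<in> {1..n}" "R i \<noteq> ?Q ?rz R i" "x \<in> \<Omega>" "y \<in> \<Omega>" "u z < u x"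
        "(x, y) \<in> R i" "(y, x) \<in> ?Q ?rz R i"
      have iA: "i \<in> A" using i(1,2) by (metis DiffI profile_D)
      have iL: "i \<in> L"
      proof (rule ccontr)
        assume "i \<notin> L"
        then have "?Q ?rz R i = R i" using iA by (simp add: profile_A)
        with i(2) show False by simp
      qed
      have yx: "(y, x) \<in> peak_pref X v z" using i(7) iA iL by (simp add: profile_A)
      have "u z \<le> u y" using in_peak_pref[OF yx] i(5) neg by (auto split: if_splits)
      moreover have "u y \<noteq> u z"
      proof
        assume "u y = u z"
        then have "y = z" by (simp add: opposite_inj[OF uv])
        with i have xz: "(x, z) \<in> R i" by simp
        show False
          using peakedD[OF uv R(1) iA z i(3) _ xz] iL i(5) by (simp add: L_def)
      qed
      ultimately show "u z < u y" by simp
    qed (use R in_Q pref in auto)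
    with 3 show False by simp
  qed
qed

text \<open>The mixed profile takes the agents of \<open>L\<close> from \<open>R\<close>, the rest
  of \<open>A\<close> from \<open>R'\<close>, and dipped agents biased to the left. Comparison with
  variants of \<open>R\<close> bounds its outcome by \<open>z\<close>. Comparison with variants of
  \<open>R'\<close> then produces the outcome \<open>z\<close> where \<open>R'\<close> forces one
  right of \<open>z\<close>.\<close>

lemma no_straddling:
  assumes R: "R \<in> Profs" "R' \<in> Profs" "\<And>i. i \<in> A \<Longrightarrow> best \<Omega> (R i) = best \<Omega> (R' i)"
    and z: "z \<in> \<Omega>" "f R < z" "z < f R'"
  shows False
proof -
  let ?I = "\<lambda>x::real. x" and ?N = "uminus :: real \<Rightarrow> real"
  note o = opposite_id opposite_sym[OF opposite_id]
  define L where "L = {i. best \<Omega> (R i) \<le> z}"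
  let ?Q = "\<lambda>l r d. profile (\<lambda>i. if i \<in> L then l i else r i) (\<lambda>_. d)"
  let ?lz = "\<lambda>_::nat. peak_pref X ?I z" and ?rz = "\<lambda>_::nat. peak_pref X ?N z"
  let ?dl = "dip_pref X ?N z" and ?dr = "dip_pref X ?I z"
  have in_Q: "?Q l r d \<in> Profs" if "\<And>i. i \<in> A \<Longrightarrow> l i \<in> single_peaked X"
    "\<And>i. i \<in> A \<Longrightarrow> r i \<in> single_peaked X" "d \<in> single_dipped X" for l r d
    using that by (auto intro!: profile_in)
  note pref = peak_pref_mem[OF o(1) z(1)] peak_pref_mem[OF o(2) z(1)] dip_pref_mem[OF o(1) z(1)] dip_pref_mem[OF o(2) z(1)]
    single_peaked_profile[OF R(1)] single_peaked_profile[OF R(2)]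
  note best_z = best_peak[OF o(1) z(1)] best_peak[OF o(2) z(1)]
  have QA: "i \<in> A \<and> ?Q l r d i = (if i \<in> L then l i else r i) \<and> ?Q l' r' d i = (if i \<in> L then l' i else r' i)"
    if "?Q l r d i \<noteq> ?Q l' r' d i" for i l r l' r' d
    using that by (auto simp: profile_def split: if_splits)
  have 1: "f (?Q R ?lz ?dl) < z"
  proof (rule change_prefs[where P = "\<lambda>x. x < z" and R = R])
    fix i x y assume i: "i \<in> {1..n}" "R i \<noteq> ?Q R ?lz ?dl i" "x \<in> \<Omega>" "y \<in> \<Omega>" "x < z"
      "(x, y) \<in> R i" "(y, x) \<in> ?Q R ?lz ?dl i"
    show "y < z"
    proof (cases "i \<in> A")
      case True
      then have iL: "i \<notin> L" and yx: "(y, x) \<in> peak_pref X ?I z"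
        using i by (auto simp: profile_A split: if_splits)
      have "y \<le> z" using in_peak_pref[OF yx] i(5) by (auto split: if_splits)
      moreover have "y \<noteq> z"
        using peakedD[OF o(2) R(1) True z(1) i(3) _] iL i(5,6) by (auto simp: L_def)
      ultimately show ?thesis by simp
    next
      case False
      then have "(y, x) \<in> ?dl" using i by (simp add: profile_D)
      from in_dip_pref[OF this] show ?thesis using i(5) by (auto split: if_splits)
    qed
  qed (use in_Q pref R z in auto)
  have 2: "z < f (?Q ?rz R' ?dr)"
  proof (rule change_prefs[where P = "\<lambda>x. z < x" and R = R'])
    fix i x y assume i: "i \<in> {1..n}" "R' i \<noteq> ?Q ?rz R' ?dr i" "x \<in> \<Omega>" "y \<in> \<Omega>" "z < x"
      "(x, y) \<in> R' i" "(y, x) \<in> ?Q ?rz R' ?dr i"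
    show "z < y"
    proof (cases "i \<in> A")
      case True
      then have iL: "i \<in> L" and yx: "(y, x) \<in> peak_pref X ?N z"
        using i by (auto simp: profile_A split: if_splits)
      have "z \<le> y" using in_peak_pref[OF yx] i(5) by (auto split: if_splits)
      moreover have "y \<noteq> z"
        using peakedD[OF o(1) R(2) True z(1) i(3) _] iL i(5,6) R(3)[OF True] by (auto simp: L_def)
      ultimately show ?thesis by simp
    next
      case False
      then have "(y, x) \<in> ?dr" using i by (simp add: profile_D)
      from in_dip_pref[OF this] show ?thesis using i(5) by (auto split: if_splits)
    qed
  qed (use in_Q pref R z in auto)
  \<comment> \<open>Otherwise the agents outside \<open>L\<close>, given top \<open>z\<close> and a
    bias to the right, would produce exactly \<open>z\<close>, as all tops are then at most
    \<open>z\<close>. Reversing their bias keeps \<open>z\<close>, against \<open>1\<close>.\<close>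
  have 3: "f (?Q R R' ?dl) \<le> z"
  proof (rule ccontr)
    assume "\<not> f (?Q R R' ?dl) \<le> z"
    then have "z \<le> f (?Q R R' ?dl)" by simp
    then have "z \<le> f (?Q R ?rz ?dl)"
    proof (rule change_prefs[where P = "\<lambda>x. z \<le> x", rotated 2])
      fix i x y assume i: "?Q R R' ?dl i \<noteq> ?Q R ?rz ?dl i" and x: "z \<le> x" and yx: "(y, x) \<in> ?Q R ?rz ?dl i"
      have "(y, x) \<in> peak_pref X ?N z" using QA[OF i] i yx by (auto split: if_splits)
      from in_peak_pref[OF this] show "z \<le> y" using x by (auto split: if_splits)
    qed (use in_Q pref in auto)
    moreover have "- z \<le> - f (?Q R ?rz ?dl)"
      by (rule best_ge_outcome_ge[OF o(2) z(1) outcome[OF R(1)]])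
        (use in_Q pref z best_z in \<open>auto simp: profile_A L_def\<close>)
    ultimately have "f (?Q R ?rz ?dl) = z" by simp
    then have "f (?Q R ?lz ?dl) = z"
      by (rule keep_outcome[rotated 2])
        (use in_Q pref best_z in \<open>auto simp: profile_A profile_D split: if_splits\<close>)
    with 1 show False by simp
  qed
  have "f (?Q ?lz R' ?dl) \<le> z"
  proof (rule change_prefs[where P = "\<lambda>x. x \<le> z" and R = "?Q R R' ?dl"])
    fix i x y assume i: "?Q R R' ?dl i \<noteq> ?Q ?lz R' ?dl i" and x: "x \<le> z" and yx: "(y, x) \<in> ?Q ?lz R' ?dl i"
    have "(y, x) \<in> peak_pref X ?I z" using QA[OF i] i yx by (auto split: if_splits)
    from in_peak_pref[OF this] show "y \<le> z" using x by (auto split: if_splits)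
  qed (use in_Q pref 3 in auto)
  moreover have "z \<le> f (?Q ?lz R' ?dl)"
    by (rule best_ge_outcome_ge[OF o(1) z(1) outcome[OF R(2)]])
      (use in_Q pref z best_z R(3) in \<open>auto simp: profile_A L_def\<close>)
  ultimately have "f (?Q ?lz R' ?dl) = z" by simp
  \<comment> \<open>The dipped agents have \<open>z\<close> at the bottom in \<open>?dl\<close>, so
    their bias can be reversed too.\<close>
  then have "f (?Q ?rz R' ?dr) = z"
  proof (rule keep_outcome[rotated 2])
    show "best \<Omega> (?Q ?rz R' ?dr i) = z" if "i \<in> A" "?Q ?lz R' ?dl i \<noteq> ?Q ?rz R' ?dr i" for i
      using that best_z by (auto simp: profile_A split: if_splits)
    show "y = z" if "i \<in> {1..n} - A" "(z, y) \<in> ?Q ?lz R' ?dl i" for i y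
      using that bottom_dip_pref[OF o(2)] by (simp add: profile_D)
  qed (use in_Q pref in auto)
  with 2 show False by simp
qed

end


subsection \<open>The order on values\<close>

lemma star_order_iff:
  "(\<alpha>, \<beta>) \<in> star_order \<Omega> \<longleftrightarrow> \<alpha> \<in> points \<Omega> \<union> adjacent_pairs \<Omega> \<and>
     \<beta> \<in> points \<Omega> \<union> adjacent_pairs \<Omega> \<and> Min \<alpha> \<le> Min \<beta> \<and> Max \<alpha> \<le> Max \<beta>"
  by (simp add: star_order_eq explicit_order_def)

lemma value_Min_Max:
  assumes "\<alpha> \<in> points \<Omega> \<union> adjacent_pairs \<Omega>"
  shows "\<alpha> = {Min \<alpha>, Max \<alpha>}"
proof -
  obtain x y where "\<alpha> = {x, y}" "Min \<alpha> = x" "Max \<alpha> = y"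
    by (rule value_cases[OF assms])
  then show ?thesis by metis
qed

lemma point_value: "z \<in> \<Omega> \<Longrightarrow> {z} \<in> points \<Omega> \<union> adjacent_pairs \<Omega>"
  by (simp add: points_def)

lemma pair_value: "adjacent \<Omega> x y \<Longrightarrow> {x, y} \<in> points \<Omega> \<union> adjacent_pairs \<Omega>"
  by (auto simp: adjacent_pairs_def)

lemma value_subset: "\<alpha> \<in> points \<Omega> \<union> adjacent_pairs \<Omega> \<Longrightarrow> \<alpha> \<subseteq> \<Omega>"
  by (auto simp: points_def adjacent_pairs_def adjacent_def)

lemma value_finite: "\<alpha> \<in> points \<Omega> \<union> adjacent_pairs \<Omega> \<Longrightarrow> finite \<alpha> \<and> \<alpha> \<noteq> {}"
  by (auto simp: points_def adjacent_pairs_def)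

lemma star_trans: "(\<alpha>, \<beta>) \<in> star_order \<Omega> \<Longrightarrow> (\<beta>, \<gamma>) \<in> star_order \<Omega> \<Longrightarrow> (\<alpha>, \<gamma>) \<in> star_order \<Omega>"
  by (auto simp: star_order_iff)

lemma star_antisym:
  assumes "(\<alpha>, \<beta>) \<in> star_order \<Omega>" "(\<beta>, \<alpha>) \<in> star_order \<Omega>"
  shows "\<alpha> = \<beta>"
proof -
  have "Min \<alpha> = Min \<beta>" "Max \<alpha> = Max \<beta>" using assms by (auto simp: star_order_iff)
  then show ?thesis
    using value_Min_Max[of \<alpha> \<Omega>] value_Min_Max[of \<beta> \<Omega>] assms unfolding star_order_iff by metis
qed

lemma star_refl: "\<alpha> \<in> points \<Omega> \<union> adjacent_pairs \<Omega> \<Longrightarrow> (\<alpha>, \<alpha>) \<in> star_order \<Omega>"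
  by (simp add: star_order_iff)

lemma star_le_point:
  assumes "\<alpha> \<in> points \<Omega> \<union> adjacent_pairs \<Omega>" "z \<in> \<Omega>"
  shows "(\<alpha>, {z}) \<in> star_order \<Omega> \<longleftrightarrow> (\<forall>x\<in>\<alpha>. x \<le> z)"
proof -
  obtain x y where "\<alpha> = {x, y}" "Min \<alpha> = x" "Max \<alpha> = y" "x \<le> y"
    by (rule value_cases[OF assms(1)])
  then show ?thesis
    using point_value[OF assms(2)] assms unfolding star_order_iff by auto
qed

lemma star_ge_point:
  assumes "\<alpha> \<in> points \<Omega> \<union> adjacent_pairs \<Omega>" "z \<in> \<Omega>" "\<forall>x\<in>\<alpha>. z \<le> x"
  shows "({z}, \<alpha>) \<in> star_order \<Omega>"
proof -
  obtain x y where "\<alpha> = {x, y}" "Min \<alpha> = x" "Max \<alpha> = y" "x \<le> y"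
    by (rule value_cases[OF assms(1)])
  then show ?thesis
    using point_value[OF assms(2)] assms unfolding star_order_iff by auto
qed

text \<open>As \<Omega> has no element strictly between \<open>x\<close> and \<open>y\<close>, one
  element of \<open>\<alpha>\<close> below \<open>y\<close> decides. The negation bounds all of
  \<open>\<alpha>\<close> from below by \<open>y\<close>, a form suited to
  \<open>outcome_le_mono\<close> in the reversed orientation.\<close>

lemma star_le_pair:
  assumes V: "\<alpha> \<in> points \<Omega> \<union> adjacent_pairs \<Omega>" and adj: "adjacent \<Omega> x y"
  shows "(\<alpha>, {x, y}) \<in> star_order \<Omega> \<longleftrightarrow> (\<exists>w\<in>\<alpha>. w < y)"
proof -
  obtain u v where a: "\<alpha> = {u, v}" "u \<in> \<Omega>" "v \<in> \<Omega>" "u = v \<or> adjacent \<Omega> u v"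
    "Min \<alpha> = u" "Max \<alpha> = v" "u \<le> v"
    by (rule value_cases[OF V])
  have xy: "x < y" "y \<in> \<Omega>" using adj by (auto simp: adjacent_def)
  have "u \<le> x \<or> y \<le> u" using adjacent_gap[OF adj a(2)] .
  moreover have "u < y \<Longrightarrow> v \<le> y"
    using a(4) adjacent_gap[of \<Omega> u v y] xy by auto
  ultimately have "u \<le> x \<and> v \<le> y \<longleftrightarrow> u < y" using xy by auto
  then show ?thesis
    using V pair_value[OF adj] a xy unfolding star_order_iff by auto
qed

lemma value_if_no_straddling:
  assumes "W \<noteq> {}" "W \<subseteq> \<Omega>" and no: "\<And>x y z. x \<in> W \<Longrightarrow> y \<in> W \<Longrightarrow> z \<in> \<Omega> \<Longrightarrow> x < z \<Longrightarrow> z < y \<Longrightarrow> False"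
  shows "W \<in> points \<Omega> \<union> adjacent_pairs \<Omega>"
proof -
  obtain x where x: "x \<in> W" using assms(1) by blast
  show ?thesis
  proof (cases "W = {x}")
    case True
    then show ?thesis using x assms(2) by (auto simp: points_def)
  next
    case False
    then obtain y where y: "y \<in> W" "y \<noteq> x" using x by blast
    have pair: "W \<in> adjacent_pairs \<Omega>" if ab: "a \<in> W" "b \<in> W" "a < b" for a b
    proof -
      have "adjacent \<Omega> a b" using no[OF ab(1,2)] ab assms(2) by (auto simp: adjacent_def)
      moreover have "w = a \<or> w = b" if w: "w \<in> W" for w
      proof (rule ccontr)
        assume "\<not> (w = a \<or> w = b)"
        then consider "w < a" | "a < w \<and> w < b" | "b < w" by linarith
        then show False
          using no[OF w ab(2), of a] no[OF ab(1,2), of w] no[OF ab(1) w, of b] ab w assms(2)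
          by cases auto
      qed
      ultimately show ?thesis using ab unfolding adjacent_pairs_def by blast
    qed
    show ?thesis using pair[of x y] pair[of y x] x y by (meson UnI2 linorder_neq_iff)
  qed
qed

subsection \<open>The median voter representation\<close>

context sp_rule
begin

abbreviation "\<omega> \<equiv> omega X n A f \<Omega>"
abbreviation "V \<equiv> points \<Omega> \<union> adjacent_pairs \<Omega>"
abbreviation "so \<equiv> star_order \<Omega>"

lemma in_omega:
  assumes "p \<in> A \<rightarrow>\<^sub>E \<Omega>"
  shows "x \<in> \<omega> p \<longleftrightarrow> (\<exists>R\<in>Profs. (\<forall>i\<in>A. best \<Omega> (R i) = p i) \<and> f R = x)"
proof -
  have "best_profile A \<Omega> R = p \<longleftrightarrow> (\<forall>i\<in>A. best \<Omega> (R i) = p i)" for R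
    using assms unfolding best_profile_def by (auto simp: fun_eq_iff PiE_def extensional_def)
  then show ?thesis using outcome unfolding omega_def by blast
qed

lemma omega_value:
  assumes p: "p \<in> A \<rightarrow>\<^sub>E \<Omega>"
  shows "\<omega> p \<in> V"
proof (rule value_if_no_straddling)
  obtain w where w: "w \<in> \<Omega>" using range_nonempty by blast
  let ?R = "profile (\<lambda>i. peak_pref X (\<lambda>x. x) (p i)) (\<lambda>_. dip_pref X (\<lambda>x. x) w)"
  have pi: "p i \<in> \<Omega>" if "i \<in> A" for i using p that by auto
  have "?R \<in> Profs" using peak_pref_mem[OF opposite_id pi] dip_pref_mem[OF opposite_id w] by (intro profile_in)
  moreover have "\<forall>i\<in>A. best \<Omega> (?R i) = p i"
    using best_peak[OF opposite_id pi] by (simp add: profile_A)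
  ultimately show "\<omega> p \<noteq> {}" using in_omega[OF p] by blast
  show "\<omega> p \<subseteq> \<Omega>" by (auto simp: omega_def)
  show False if "x \<in> \<omega> p" "y \<in> \<omega> p" "z \<in> \<Omega>" "x < z" "z < y" for x y z
    using that in_omega[OF p] no_straddling[OF _ _ _ that(3)] by metis
qed

text \<open>Giving the agents of \<open>A\<close> the top \<open>z\<close> preserves an outcome
  \<open>z\<close>. Unlike unanimity, this covers the ends of \<Omega>.\<close>

lemma constant_in_omega:
  assumes z: "z \<in> \<Omega>"
  shows "z \<in> \<omega> (\<lambda>i\<in>A. z)"
proof -
  obtain R where R: "R \<in> Profs" "f R = z" using range z by auto
  let ?Q = "profile (\<lambda>_. peak_pref X (\<lambda>x. x) z) R"
  have Q: "?Q \<in> Profs"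
    using peak_pref_mem[OF opposite_id z] single_dipped_profile[OF R(1)] by (intro profile_in)
  have best: "best \<Omega> (?Q i) = z" if "i \<in> A" for i
    using that best_peak[OF opposite_id z] by (simp add: profile_A)
  have "f ?Q = z"
    by (rule keep_outcome[OF R(1) Q R(2)]) (auto simp: best profile_D)
  then show ?thesis using Q best z by (subst in_omega) auto
qed

lemma omega_interior:
  assumes z: "m \<in> \<Omega>" "z \<in> \<Omega>" "M \<in> \<Omega>" "m < z" "z < M"
  shows "\<omega> (\<lambda>i\<in>A. z) = {z}"
proof -
  have p: "(\<lambda>i\<in>A. z) \<in> A \<rightarrow>\<^sub>E \<Omega>" using z by auto
  have "x = z" if "x \<in> \<omega> (\<lambda>i\<in>A. z)" for x
    using that unanimity[OF z] unfolding in_omega[OF p] by auto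
  then show ?thesis using constant_in_omega[OF z(2)] by blast
qed

text \<open>A point is handled by \<open>outcome_le_mono\<close> directly. For a pair, failure means
  that all outcomes for \<open>q\<close> are at least \<open>y\<close>, and the reversed orientation
  passes this on to \<open>p\<close>.\<close>

lemma omega_mono:
  assumes p: "p \<in> A \<rightarrow>\<^sub>E \<Omega>" and q: "q \<in> A \<rightarrow>\<^sub>E \<Omega>" and \<alpha>: "\<alpha> \<in> V"
    and sub: "\<And>i. i \<in> A \<Longrightarrow> ({p i}, \<alpha>) \<in> so \<Longrightarrow> ({q i}, \<alpha>) \<in> so"
    and le: "(\<omega> p, \<alpha>) \<in> so"
  shows "(\<omega> q, \<alpha>) \<in> so"
proof -
  have pq: "p i \<in> \<Omega>" "q i \<in> \<Omega>" if "i \<in> A" for i using p q that by auto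
  note val = point_value[OF pq(1)] point_value[OF pq(2)] omega_value[OF p] omega_value[OF q]
  obtain x y where xy: "\<alpha> = {x, y}" "x \<in> \<Omega>" "y \<in> \<Omega>" "x = y \<or> adjacent \<Omega> x y"
    by (rule value_cases[OF \<alpha>])
  show ?thesis
  proof (cases "x = y")
    case True
    then have \<alpha>x: "\<alpha> = {x}" using xy by simp
    have sub': "p i \<le> x \<Longrightarrow> q i \<le> x" if "i \<in> A" for i
      using sub[OF that] star_le_point[OF val(1)[OF that] xy(2)] star_le_point[OF val(2)[OF that] xy(2)]
      unfolding \<alpha>x by auto
    have low: "f R \<le> x" if "R \<in> Profs" "\<And>i. i \<in> A \<Longrightarrow> best \<Omega> (R i) = p i" for R
      using le that star_le_point[OF val(3) xy(2)] in_omega[OF p] unfolding \<alpha>x by blast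
    have "f R \<le> x" if "R \<in> Profs" "\<forall>i\<in>A. best \<Omega> (R i) = q i" for R
      using outcome_le_mono[OF opposite_id xy(2), of p R] pq low sub' that by auto
    then show ?thesis
      unfolding \<alpha>x star_le_point[OF val(4) xy(2)] by (auto simp: in_omega[OF q])
  next
    case False
    then have adj: "adjacent \<Omega> x y" using xy by simp
    have sub': "p i < y \<Longrightarrow> q i < y" if "i \<in> A" for i
      using sub[OF that] star_le_pair[OF val(1)[OF that] adj] star_le_pair[OF val(2)[OF that] adj]
      unfolding xy by auto
    show ?thesis
    proof (rule ccontr)
      assume "\<not> ?thesis"
      then have no: "\<not> (\<exists>w\<in>\<omega> q. w < y)" using star_le_pair[OF val(4) adj] xy by simp
      have low: "- f R \<le> - y" if "R \<in> Profs" "\<And>i. i \<in> A \<Longrightarrow> best \<Omega> (R i) = q i" for R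
        using no that in_omega[OF q] by force
      have "- f R \<le> - y" if "R \<in> Profs" "\<forall>i\<in>A. best \<Omega> (R i) = p i" for R
        using outcome_le_mono[OF opposite_sym[OF opposite_id] xy(3), of q R] pq low sub' that
        by (force simp: not_less[symmetric])
      then have "\<not> (\<exists>w\<in>\<omega> p. w < y)" using in_omega[OF p] by force
      then show False using le star_le_pair[OF val(3) adj] xy by simp
    qed
  qed
qed

text \<open>With \<open>A\<close> empty every profile is vacuously in \<open>Peaked z\<close>, so
  unanimity at an alternative with others on both sides would make \<open>f\<close> constant. A
  missing maximum would supply such an alternative.\<close>

lemma max_exists_if_no_peaked:
  assumes "A = {}"
  shows "\<exists>M. is_max \<Omega> M"
proof (rule ccontr)
  assume no: "\<nexists>M. is_max \<Omega> M"
  obtain x y where xy: "x \<in> \<Omega>" "y \<in> \<Omega>" "x < y" using two by (meson linorder_neq_iff)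
  obtain w where w: "w \<in> \<Omega>" "y < w" using no xy(2) unfolding is_max_def by (meson not_le)
  have "f R = y" if "R \<in> Profs" for R
    using unanimity[OF xy(1,2) w(1) xy(3) w(2)] that assms by auto
  then show False using range xy by auto
qed

text \<open>The hypotheses say that the empty coalition is decisive at \<open>\<alpha>\<close>. If
  \<open>A\<close> is nonempty, some outcome then lies left of the smallest top \<open>z\<close>; by
  \<open>best_ge_outcome_ge\<close> nothing in \<Omega> exceeds \<open>z\<close>, so all tops are
  the maximum.\<close>

lemma empty_coalition:
  assumes p: "p \<in> A \<rightarrow>\<^sub>E \<Omega>" and \<alpha>: "\<alpha> \<in> V"
    and above: "\<And>i. i \<in> A \<Longrightarrow> ({p i}, \<alpha>) \<notin> so" and le: "(\<omega> p, \<alpha>) \<in> so"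
  shows "\<exists>M. is_max \<Omega> M \<and> M \<in> \<omega> p"
proof (cases "A = {}")
  case True
  then obtain M where M: "is_max \<Omega> M" using max_exists_if_no_peaked by blast
  then obtain R where "R \<in> Profs" "f R = M" using range by (auto simp: is_max_def)
  then show ?thesis using M True in_omega[OF p] by auto
next
  case False
  have fin: "finite A" using agents finite_subset by blast
  define z where "z = Min (p ` A)"
  have "z \<in> p ` A" unfolding z_def using fin False by (intro Min_in) auto
  then obtain j where j: "j \<in> A" "z = p j" by blast
  have z: "z \<in> \<Omega>" using p j by auto
  have zp: "z \<le> p i" if "i \<in> A" for i unfolding z_def using fin that by simp
  have "\<not> (\<forall>x\<in>\<omega> p. z \<le> x)"
    using star_ge_point[OF omega_value[OF p] z] above[OF j(1)] j(2) star_trans[OF _ le] by blast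
  then obtain R where R: "R \<in> Profs" "\<forall>i\<in>A. best \<Omega> (R i) = p i" "f R < z"
    using in_omega[OF p] by force
  have max: "x \<le> z" if "x \<in> \<Omega>" for x
  proof (rule ccontr)
    assume "\<not> x \<le> z"
    then have "z < x" by simp
    from best_ge_outcome_ge[OF opposite_id z that this R(1)] R(2,3) zp show False by simp
  qed
  have "p = (\<lambda>i\<in>A. z)"
  proof (rule PiE_ext[OF p])
    show "p i = (\<lambda>i\<in>A. z) i" if "i \<in> A" for i
      using max[of "p i"] zp[OF that] p that by (auto simp: PiE_mem)
  qed (use z in auto)
  then show ?thesis using constant_in_omega[OF z] z max by (auto simp: is_max_def)
qed

text \<open>Supplies a top that keeps an agent out of the coalition at
  \<open>\<beta>\<close>.\<close>

lemma not_all_below: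
  assumes "\<beta> \<in> V" "\<not> (\<exists>m. is_max \<Omega> m \<and> \<beta> = {m})"
  obtains w where "w \<in> \<Omega>" "({w}, \<beta>) \<notin> so"
proof -
  obtain x y where xy: "\<beta> = {x, y}" "x \<in> \<Omega>" "y \<in> \<Omega>" "x = y \<or> adjacent \<Omega> x y"
    by (rule value_cases[OF assms(1)])
  show thesis
  proof (cases "x = y")
    case True
    then obtain w where "w \<in> \<Omega>" "x < w" using assms(2) xy by (force simp: is_max_def)
    then show thesis using that[of w] star_le_point[OF point_value xy(2)] xy True by auto
  next
    case False
    then show thesis using that[of y] star_le_pair[OF point_value[OF xy(3)]] xy by auto
  qed
qed

text \<open>Constant vectors witness all three conditions: interior points by unanimity, while the
  value at an end \<open>m\<close> contains \<open>m\<close> and hence is \<open>{m}\<close> or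
  pairs \<open>m\<close> with its neighbour.\<close>

lemma range_conditions_omega: "range_conditions \<Omega> (\<omega> ` (A \<rightarrow>\<^sub>E \<Omega>))"
proof -
  let ?r = "\<omega> ` (A \<rightarrow>\<^sub>E \<Omega>)"
  have const: "(\<lambda>i\<in>A. z) \<in> A \<rightarrow>\<^sub>E \<Omega>" if "z \<in> \<Omega>" for z using that by auto
  have "{z} \<in> ?r" if z: "z \<in> \<Omega>" and inner: "\<not> is_min \<Omega> z" "\<not> is_max \<Omega> z" for z
  proof -
    obtain m M where "m \<in> \<Omega>" "M \<in> \<Omega>" "m < z" "z < M"
      using z inner unfolding is_min_def is_max_def by (meson not_le)
    then have "\<omega> (\<lambda>i\<in>A. z) = {z}" using omega_interior z by blast
    then show ?thesis using const[OF z] by (metis imageI)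
  qed
  then have 1: "points {x \<in> \<Omega>. \<not> is_min \<Omega> x \<and> \<not> is_max \<Omega> x} \<subseteq> ?r"
    by (auto simp: points_def)
  have end_value: "\<omega> (\<lambda>i\<in>A. m) = {m} \<or> (\<exists>x\<in>\<Omega>. x \<noteq> m \<and> \<omega> (\<lambda>i\<in>A. m) = {x, m})" if m: "m \<in> \<Omega>" for m
  proof -
    obtain x y where "\<omega> (\<lambda>i\<in>A. m) = {x, y}" "x \<in> \<Omega>" "y \<in> \<Omega>"
      by (rule value_cases[OF omega_value[OF const[OF m]]])
    then show ?thesis using constant_in_omega[OF m] by (auto simp: insert_commute)
  qed
  have 2: "{m} \<in> ?r" if m: "is_min \<Omega> m" "\<not> (\<exists>x\<in>\<Omega>. m < x \<and> {m, x} \<in> ?r)" for m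
  proof -
    have m': "m \<in> \<Omega>" using m(1) by (simp add: is_min_def)
    have in_r: "\<omega> (\<lambda>i\<in>A. m) \<in> ?r" using const[OF m'] by blast
    from end_value[OF m'] show ?thesis
    proof (elim disjE bexE conjE)
      fix x assume x: "x \<in> \<Omega>" "x \<noteq> m" "\<omega> (\<lambda>i\<in>A. m) = {x, m}"
      then have "m < x" using m(1) by (simp add: is_min_def less_le)
      then show ?thesis using m(2) x(1) in_r unfolding x(3) insert_commute[of x m] by blast
    qed (use in_r in simp)
  qed
  have 3: "{m} \<in> ?r" if m: "is_max \<Omega> m" "\<not> (\<exists>x\<in>\<Omega>. x < m \<and> {x, m} \<in> ?r)" for m
  proof -
    have m': "m \<in> \<Omega>" using m(1) by (simp add: is_max_def)
    have in_r: "\<omega> (\<lambda>i\<in>A. m) \<in> ?r" using const[OF m'] by blast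
    from end_value[OF m'] show ?thesis
    proof (elim disjE bexE conjE)
      fix x assume x: "x \<in> \<Omega>" "x \<noteq> m" "\<omega> (\<lambda>i\<in>A. m) = {x, m}"
      then have "x < m" using m(1) by (simp add: is_max_def less_le)
      then show ?thesis using m(2) x(1) in_r unfolding x(3) by blast
    qed (use in_r in simp)
  qed
  show ?thesis
    unfolding range_conditions_def
  proof (intro conjI allI impI)
    show "?r \<subseteq> V" using omega_value by auto
    show "{m} \<in> ?r" if "is_min \<Omega> m \<and> \<not> (\<exists>x\<in>\<Omega>. m < x \<and> {m, x} \<in> ?r)" for m
      by (rule 2[OF conjunct1[OF that] conjunct2[OF that]])
    show "{m} \<in> ?r" if "is_max \<Omega> m \<and> \<not> (\<exists>x\<in>\<Omega>. x < m \<and> {x, m} \<in> ?r)" for m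
      by (rule 3[OF conjunct1[OF that] conjunct2[OF that]])
  qed (rule 1)
qed

text \<open>By \<open>L_iff\<close>, the coalition of \<open>p\<close> at \<open>\<alpha>\<close>
  belongs to \<open>L \<alpha>\<close> exactly when \<open>\<omega> p\<close> is weakly below
  \<open>\<alpha>\<close>. The representation then says that \<open>\<omega> p\<close> is the least
  value weakly above itself.\<close>

lemma generalized_median_voter_omega:
  "generalized_median_voter_function A \<Omega> (\<omega> ` (A \<rightarrow>\<^sub>E \<Omega>)) \<omega>"
proof -
  let ?r = "\<omega> ` (A \<rightarrow>\<^sub>E \<Omega>)"
  define B where "B = (\<lambda>p \<alpha>. {i \<in> A. ({p i}, \<alpha>) \<in> so})"
  \<comment> \<open>At \<open>{max \<Omega>}\<close> every \<open>B p\<close> is all of \<open>A\<close>, so the generic formula would yield at most \<open>{A}\<close>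
    and violate monotonicity in \<open>\<alpha>\<close>.\<close>
  define L where "L = (\<lambda>\<alpha>. if \<exists>m. is_max \<Omega> m \<and> \<alpha> = {m} then Pow A
    else {C. C \<subseteq> A \<and> (\<exists>p\<in>A \<rightarrow>\<^sub>E \<Omega>. B p \<alpha> \<subseteq> C \<and> (\<omega> p, \<alpha>) \<in> so)})"
  have L_other: "L \<alpha> = {C. C \<subseteq> A \<and> (\<exists>p\<in>A \<rightarrow>\<^sub>E \<Omega>. B p \<alpha> \<subseteq> C \<and> (\<omega> p, \<alpha>) \<in> so)}"
    if "\<not> (\<exists>m. is_max \<Omega> m \<and> \<alpha> = {m})" for \<alpha>
    unfolding L_def using that by (rule if_not_P)
  have r: "\<alpha> \<in> V" if "\<alpha> \<in> ?r" for \<alpha> using that omega_value by auto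
  have below_max: "(\<alpha>, {m}) \<in> so" if "is_max \<Omega> m" "\<alpha> \<in> V" for \<alpha> m
    using that value_subset[OF that(2)] star_le_point[OF that(2), of m] by (auto simp: is_max_def)
  have L_iff: "B p \<alpha> \<in> L \<alpha> \<longleftrightarrow> (\<omega> p, \<alpha>) \<in> so" if p: "p \<in> A \<rightarrow>\<^sub>E \<Omega>" and \<alpha>: "\<alpha> \<in> ?r" for p \<alpha>
  proof (cases "\<exists>m. is_max \<Omega> m \<and> \<alpha> = {m}")
    case True
    then show ?thesis using below_max omega_value[OF p] by (auto simp: L_def B_def)
  next
    case False
    have "(\<omega> p, \<alpha>) \<in> so" if "q \<in> A \<rightarrow>\<^sub>E \<Omega>" "B q \<alpha> \<subseteq> B p \<alpha>" "(\<omega> q, \<alpha>) \<in> so" for q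
      using omega_mono[OF that(1) p r[OF \<alpha>] _ that(3)] that(2) by (auto simp: B_def)
    moreover have "B p \<alpha> \<subseteq> A" by (auto simp: B_def)
    ultimately show ?thesis unfolding L_other[OF False] using p by blast
  qed
  \<comment> \<open>This serves both conditions on the empty coalition, with and without a maximum
    of \<Omega>.\<close>
  have empty: "\<exists>M. is_max \<Omega> M \<and> (\<exists>p\<in>A \<rightarrow>\<^sub>E \<Omega>. M \<in> \<omega> p \<and> (\<omega> p, \<alpha>) \<in> so)"
    if \<alpha>: "\<alpha> \<in> ?r" "{} \<in> L \<alpha>" for \<alpha>
  proof (cases "\<exists>m. is_max \<Omega> m \<and> \<alpha> = {m}")
    case True
    then obtain m p where "is_max \<Omega> m" "\<alpha> = {m}" "p \<in> A \<rightarrow>\<^sub>E \<Omega>" "\<alpha> = \<omega> p" using \<alpha>(1) by blast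
    then show ?thesis using star_refl[OF omega_value] by (metis insertI1)
  next
    case False
    then obtain p where "p \<in> A \<rightarrow>\<^sub>E \<Omega>" "B p \<alpha> = {}" "(\<omega> p, \<alpha>) \<in> so"
      using \<alpha>(2) unfolding L_other[OF False] by blast
    then show ?thesis using empty_coalition[of p \<alpha>] r[OF \<alpha>(1)] unfolding B_def by blast
  qed
  have up: "C \<in> L \<beta>" if \<alpha>: "\<alpha> \<in> ?r" and \<beta>: "\<beta> \<in> ?r" and lt: "strict_part so \<alpha> \<beta>" and C: "C \<in> L \<alpha>" for \<alpha> \<beta> C
  proof (cases "\<exists>m. is_max \<Omega> m \<and> \<beta> = {m}")
    case True
    then show ?thesis using C by (auto simp: L_def split: if_splits)
  next
    case False
    have \<alpha>\<beta>: "(\<alpha>, \<beta>) \<in> so" "(\<beta>, \<alpha>) \<notin> so" using lt by (auto simp: strict_part_def)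
    have notmax: "\<not> (\<exists>m. is_max \<Omega> m \<and> \<alpha> = {m})" using \<alpha>\<beta>(2) below_max r[OF \<beta>] by blast
    obtain p where p: "C \<subseteq> A" "p \<in> A \<rightarrow>\<^sub>E \<Omega>" "B p \<alpha> \<subseteq> C" "(\<omega> p, \<alpha>) \<in> so"
      using C unfolding L_other[OF notmax] by blast
    obtain w where w: "w \<in> \<Omega>" "({w}, \<beta>) \<notin> so" using not_all_below[OF r[OF \<beta>] False] .
    \<comment> \<open>At \<open>\<beta>\<close> the coalition of \<open>p\<close> may gain members.
      Moving the tops not weakly below \<open>\<alpha>\<close> to \<open>w\<close> prevents this and
      leaves the coalition at \<open>\<alpha>\<close> large enough for
      \<open>omega_mono\<close>.\<close>
    define q where "q = (\<lambda>i\<in>A. if ({p i}, \<alpha>) \<in> so then p i else w)"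
    have q: "q \<in> A \<rightarrow>\<^sub>E \<Omega>" using p(2) w(1) by (auto simp: q_def PiE_mem)
    have "(\<omega> q, \<alpha>) \<in> so"
      by (rule omega_mono[OF p(2) q r[OF \<alpha>] _ p(4)]) (simp add: q_def)
    then have "(\<omega> q, \<beta>) \<in> so" using \<alpha>\<beta>(1) star_trans by blast
    moreover have "B q \<beta> \<subseteq> C"
      using p(3) w(2) by (auto simp: B_def q_def split: if_splits)
    ultimately show ?thesis unfolding L_other[OF False] using p(1) q by blast
  qed
  have sys: "left_coalition_system A \<Omega> ?r L"
    unfolding left_coalition_system_def
  proof (intro conjI ballI allI impI)
    show "L \<alpha> \<subseteq> Pow A" for \<alpha> by (auto simp: L_def)
    show "C' \<in> L \<alpha>" if C: "C \<in> L \<alpha> \<and> C \<subseteq> C' \<and> C' \<subseteq> A" for \<alpha> C C'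
    proof (cases "\<exists>m. is_max \<Omega> m \<and> \<alpha> = {m}")
      case False
      then obtain p where "p \<in> A \<rightarrow>\<^sub>E \<Omega>" "B p \<alpha> \<subseteq> C" "(\<omega> p, \<alpha>) \<in> so"
        using C unfolding L_other[OF False] by blast
      with C show ?thesis unfolding L_other[OF False] by blast
    qed (use C in \<open>auto simp: L_def\<close>)
    show "C \<in> L \<beta>" if "\<alpha> \<in> ?r" "\<beta> \<in> ?r" "strict_part so \<alpha> \<beta> \<and> C \<in> L \<alpha>" for \<alpha> \<beta> C
      using up that by blast
    show "{} \<notin> L \<alpha>" if "\<nexists>m. is_max \<Omega> m" "\<alpha> \<in> ?r" for \<alpha>
      using empty that by blast
    fix M assume M: "is_max \<Omega> M \<and> {M} \<notin> ?r"
    then have MO: "M \<in> \<Omega>" by (simp add: is_max_def)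
    have const: "(\<lambda>i\<in>A. M) \<in> A \<rightarrow>\<^sub>E \<Omega>" using MO by auto
    \<comment> \<open>As \<open>{M}\<close> is not a value, a value containing \<open>M\<close> must
      pair it with its predecessor, and only \<open>{M}\<close> lies above that pair.\<close>
    have top: "(\<alpha>, \<omega> p) \<in> so" if p: "p \<in> A \<rightarrow>\<^sub>E \<Omega>" "M \<in> \<omega> p" and \<alpha>: "\<alpha> \<in> ?r" for p \<alpha>
    proof -
      obtain x y where xy: "\<omega> p = {x, y}" "x = y \<or> adjacent \<Omega> x y" "y \<in> \<Omega>"
        by (rule value_cases[OF omega_value[OF p(1)]])
      have "\<omega> p \<noteq> {M}" using M p(1) by blast
      with xy p(2) M have adj: "adjacent \<Omega> x y" and "y = M"
        by (auto simp: is_max_def adjacent_def)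
      have "\<alpha> \<subseteq> \<Omega>" "\<alpha> \<noteq> {}" "\<alpha> \<noteq> {M}"
        using value_subset value_finite r[OF \<alpha>] M \<alpha> by blast+
      then obtain w where "w \<in> \<alpha>" "w < M" using M by (force simp: is_max_def less_le)
      then show ?thesis using star_le_pair[OF r[OF \<alpha>] adj] xy(1) \<open>y = M\<close> by auto
    qed
    let ?\<mu> = "\<omega> (\<lambda>i\<in>A. M)"
    have \<mu>: "?\<mu> \<in> ?r" "M \<in> ?\<mu>" using const constant_in_omega[OF MO] by auto
    show "\<exists>\<mu>\<in>?r. (\<forall>\<alpha>\<in>?r. (\<alpha>, \<mu>) \<in> so) \<and> {} \<in> L \<mu> \<and> (\<forall>\<alpha>\<in>?r - {\<mu>}. {} \<notin> L \<alpha>)"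
    proof (intro bexI[OF _ \<mu>(1)] conjI ballI)
      show "(\<alpha>, ?\<mu>) \<in> so" if "\<alpha> \<in> ?r" for \<alpha> using top[OF const \<mu>(2) that] .
      have "({M}, ?\<mu>) \<notin> so"
        using star_antisym[OF _ below_max[of M ?\<mu>]] M \<mu>(1) r by metis
      then have "B (\<lambda>i\<in>A. M) ?\<mu> = {}" by (auto simp: B_def)
      then show "{} \<in> L ?\<mu>"
        using L_iff[OF const \<mu>(1)] star_refl[OF r[OF \<mu>(1)]] by simp
      show "{} \<notin> L \<alpha>" if \<alpha>: "\<alpha> \<in> ?r - {?\<mu>}" for \<alpha>
      proof
        assume "{} \<in> L \<alpha>"
        with empty[of \<alpha>] \<alpha> obtain M' p where p: "is_max \<Omega> M'" "p \<in> A \<rightarrow>\<^sub>E \<Omega>" "M' \<in> \<omega> p" "(\<omega> p, \<alpha>) \<in> so"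
          by blast
        have "M' = M" using p(1) M by (force simp: is_max_def)
        then have "(?\<mu>, \<alpha>) \<in> so"
          using top[OF p(2) _ \<mu>(1)] p(3,4) star_trans by blast
        moreover have "(\<alpha>, ?\<mu>) \<in> so" using top[OF const \<mu>(2)] \<alpha> by blast
        ultimately show False using star_antisym \<alpha> by blast
      qed
    qed
  qed
  have "\<omega> p = \<alpha> \<longleftrightarrow> (\<omega> p, \<alpha>) \<in> so \<and> (\<forall>\<beta>\<in>?r. strict_part so \<beta> \<alpha> \<longrightarrow> (\<omega> p, \<beta>) \<notin> so)"
    if p: "p \<in> A \<rightarrow>\<^sub>E \<Omega>" and \<alpha>: "\<alpha> \<in> ?r" for p \<alpha>
  proof
    assume "\<omega> p = \<alpha>"
    then show "(\<omega> p, \<alpha>) \<in> so \<and> (\<forall>\<beta>\<in>?r. strict_part so \<beta> \<alpha> \<longrightarrow> (\<omega> p, \<beta>) \<notin> so)"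
      using star_refl[OF omega_value[OF p]] by (auto simp: strict_part_def)
  next
    assume h: "(\<omega> p, \<alpha>) \<in> so \<and> (\<forall>\<beta>\<in>?r. strict_part so \<beta> \<alpha> \<longrightarrow> (\<omega> p, \<beta>) \<notin> so)"
    then have "\<not> strict_part so (\<omega> p) \<alpha>" using p star_refl[OF omega_value[OF p]] by blast
    with h show "\<omega> p = \<alpha>" using star_antisym by (auto simp: strict_part_def)
  qed
  with L_iff sys show ?thesis
    unfolding generalized_median_voter_function_def by (intro exI[of _ L]) (simp add: B_def)
qed

end

theorem proposition3:
  fixes X \<Omega> :: "real set" and n :: nat and A :: "nat set"
    and f :: "(nat \<Rightarrow> real rel) \<Rightarrow> real"
    and \<omega> :: "(nat \<Rightarrow> real) \<Rightarrow> real set" and r :: "real set set"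
  assumes agents: "A \<subseteq> {1..n}"
    and rule: "f \<in> profiles X n A \<rightarrow> X"
    and range: "\<Omega> = f ` profiles X n A"
    and complement_open: "open (- \<Omega>)"
    and two: "\<exists>x\<in>\<Omega>. \<exists>y\<in>\<Omega>. x \<noteq> y"
    and SP: "strategy_proof X n A f"
    and omega: "\<omega> = omega X n A f \<Omega>"
    and r: "r = \<omega> ` (A \<rightarrow>\<^sub>E \<Omega>)"
  shows "generalized_median_voter_function A \<Omega> r \<omega> \<and> range_conditions \<Omega> r"
proof -
  interpret sp_rule X \<Omega> n A f
    using agents rule range complement_open two SP by (rule sp_rule.intro)
  show ?thesis
    unfolding r omega using generalized_median_voter_omega range_conditions_omega by blast
qed

end
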